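(* For any integer $\ell \ge 7$, \[ \mathrm{ex}(n, C^{\Join-}_{2\ell}) \le \mathrm{ex}(n, C^{\Join}_{2\ell}) = O(n^{3/2}). \]
   Context: $\mathrm{ex}(n,H)$ is the maximum number of edges in an $n$-vertex graph containing no subgraph isomorphic to $H$; $O$ refers to $n\to\infty$ with constant depending on $\ell$. The Cartesian product $G\,\square\,H$ has vertex set $V(G)\times V(H)$, with $(u,v)$ adjacent to $(u',v')$ iff either $u=u'$ and $vv'\in E(H)$, or $v=v'$ and $uu'\in E(G)$; an edge with $u=u'$ is of type $H$, and one with $v=v'$ is of type $G$. The prism graph is $C^{\square}_{2\ell} := C_{2\ell}\,\square\,K_2$ (two disjoint $2\ell$-cycles, whose edges are of type $C_{2\ell}$, joined by a perfect matching of edges of type $K_2$). $C^{\Join}_{2\ell}$ is the graph obtained by gluing two vertex-disjoint copies of $C^{\square}_{2\ell}$ along one edge of type $K_2$ (identifying that edge and its two endpoints). $C^{\Join-}_{2\ell}$ is obtained from $C^{\Join}_{2\ell}$ by deleting the merged edge $e_1$ and one further edge $e_2$ that shares exactly one vertex with $e_1$. *)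

theory Defs
  imports Complex_Main "HOL-Library.Landau_Symbols"
begin

record 'a ugraph =
  verts :: "'a set"
  edges :: "'a set set"

definition simple_graph :: "'a ugraph \<Rightarrow> bool" where
  "simple_graph G \<longleftrightarrow> finite (verts G) \<and> (\<forall>e \<in> edges G. e \<subseteq> verts G \<and> card e = 2)"

definition is_subgraph :: "'a ugraph \<Rightarrow> 'a ugraph \<Rightarrow> bool" where
  "is_subgraph S G \<longleftrightarrow> simple_graph S \<and> verts S \<subseteq> verts G \<and> edges S \<subseteq> edges G"

definition graph_iso :: "'a ugraph \<Rightarrow> 'b ugraph \<Rightarrow> bool" where
  "graph_iso G H \<longleftrightarrow> (\<exists>f. bij_betw f (verts G) (verts H) \<and>
     (\<forall>u \<in> verts G. \<forall>v \<in> verts G. {u, v} \<in> edges G \<longleftrightarrow> {f u, f v} \<in> edges H))"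

definition contains_copy :: "'a ugraph \<Rightarrow> 'b ugraph \<Rightarrow> bool" where
  "contains_copy G H \<longleftrightarrow> (\<exists>S. is_subgraph S G \<and> graph_iso H S)"

text \<open>
  Every finite graph is isomorphic to one with vertices in \<^typ>\<open>nat\<close>, so nothing is lost by
  fixing the vertex type of the host graphs. The set below is finite, and it is nonempty whenever
  \<open>H\<close> has an edge, since the edgeless graph on \<open>n\<close> vertices is then a member;
  in the remaining cases the value may be unspecified.
\<close>

definition ex_num :: "nat \<Rightarrow> 'b ugraph \<Rightarrow> nat" where
  "ex_num n H = Max {card (edges G) | G :: nat ugraph.
     simple_graph G \<and> card (verts G) = n \<and> \<not> contains_copy G H}"

text \<open>A simple \<open>k\<close>-cycle only for \<open>k \<ge> 3\<close>.\<close>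

definition cycle_graph :: "nat \<Rightarrow> nat ugraph" where
  "cycle_graph k = \<lparr>verts = {..<k}, edges = {{i, (i + 1) mod k} | i. i < k}\<rparr>"

definition complete_graph :: "nat \<Rightarrow> nat ugraph" where
  "complete_graph k = \<lparr>verts = {..<k}, edges = {e. e \<subseteq> {..<k} \<and> card e = 2}\<rparr>"

definition cartesian_product :: "'a ugraph \<Rightarrow> 'b ugraph \<Rightarrow> ('a \<times> 'b) ugraph" where
  "cartesian_product G H = \<lparr>verts = verts G \<times> verts H,
     edges = {{(u, v), (u, v')} | u v v'. u \<in> verts G \<and> {v, v'} \<in> edges H} \<union>
             {{(u, v), (u', v)} | u u' v. v \<in> verts H \<and> {u, u'} \<in> edges G}\<rparr>"

definition prism_graph :: "nat \<Rightarrow> (nat \<times> nat) ugraph" where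
  "prism_graph l = cartesian_product (cycle_graph (2 * l)) (complete_graph 2)"

text \<open>
  Two disjoint copies \<open>Inl ` G\<close> and \<open>Inr ` G\<close> are glued along \<open>e\<close> by redirecting each
  \<open>Inr x\<close> with \<open>x \<in> e\<close> to \<open>Inl x\<close>; the merged edge is therefore \<open>Inl ` e\<close>.
\<close>

definition identify_on :: "'a set \<Rightarrow> 'a + 'a \<Rightarrow> 'a + 'a" where
  "identify_on e z = (case z of Inl x \<Rightarrow> Inl x | Inr x \<Rightarrow> if x \<in> e then Inl x else Inr x)"

definition disjoint_copies :: "'a ugraph \<Rightarrow> ('a + 'a) ugraph" where
  "disjoint_copies G = \<lparr>verts = verts G <+> verts G,
     edges = ((`) Inl) ` edges G \<union> ((`) Inr) ` edges G\<rparr>"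

definition glue_copies :: "'a ugraph \<Rightarrow> 'a set \<Rightarrow> ('a + 'a) ugraph" where
  "glue_copies G e = \<lparr>verts = identify_on e ` verts (disjoint_copies G),
     edges = ((`) (identify_on e)) ` edges (disjoint_copies G)\<rparr>"

text \<open>
  The automorphisms of the prism act transitively on the edges of type \<open>K\<^sub>2\<close> and can reverse
  such an edge, so the glued graph does not depend, up to isomorphism, on the edge chosen in
  either copy or on the direction in which the two edges are identified.
\<close>

definition glued_edge :: "(nat \<times> nat) set" where
  "glued_edge = {(0, 0), (0, 1)}"

definition bowtie_graph :: "nat \<Rightarrow> ((nat \<times> nat) + (nat \<times> nat)) ugraph" where
  "bowtie_graph l = glue_copies (prism_graph l) glued_edge"

definition merged_edge :: "((nat \<times> nat) + (nat \<times> nat)) set" where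
  "merged_edge = Inl ` glued_edge"

definition bowtie_minus_graph ::
    "nat \<Rightarrow> ((nat \<times> nat) + (nat \<times> nat)) set \<Rightarrow> ((nat \<times> nat) + (nat \<times> nat)) ugraph" where
  "bowtie_minus_graph l e2 =
     (bowtie_graph l)\<lparr>edges := edges (bowtie_graph l) - {merged_edge, e2}\<rparr>"

end

theory Submission
  imports Defs "HOL-Analysis.Analysis"
begin

text \<open>
  Call a cyclic sequence of edges \<open>a\<^sub>i b\<^sub>i\<close> (the rungs) in which consecutive rungs span a 4-cycle a
  ladder; a ladder of even length with all vertices distinct is a prism. Ladders are closed walks in
  an auxiliary graph on the edges of the host graph, in which the step from \<open>(x, b)\<close> to \<open>(y, c)\<close> gets
  the weight \<open>1 / codeg(x, y)\<close>. Two facts about weighted closed walks of length \<open>2k\<close> are needed: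
  their total weight is large, by convexity of the moments of the weight matrix, and those
  in which two given positions share a vertex are few, by one application of Cauchy-Schwarz, as
  soon as every rung has only a small weight of neighbours through any given vertex. Choosing for
  each rung one good closed walk through it and treating its vertices as forbidden
  as well turns a prism into two prisms glued along a rung.

  The second fact fails if 4-cycles have diagonals of large codegree. To exclude this, pass
  to vertex sets \<open>A\<close>, \<open>B\<close> maximising the edge number relative to
  \<open>\<phi>(s, t) = (s t)\<^bsup>3/4\<^esup> + s t\<^bsup>15/32\<^esup> + t s\<^bsup>15/32\<^esup>\<close>. Then \<open>A\<close>, \<open>B\<close> can be taken almost balanced and
  without vertices of large degree. Applied to the neighbourhood of a vertex \<open>b\<close> and the set of vertices
  whose codegree with \<open>b\<close> exceeds a constant times \<open>f \<surd>d\<close>, where \<open>d\<close> is the average degree and \<open>f\<close> the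
  maximal density, maximality shows that only a small proportion of the 4-cycles has such a diagonal.
  The remaining 4-cycles suffice if \<open>(\<surd>d)\<^sup>k\<close> beats the number of rungs, which is at most \<open>d\<^bsup>17/5\<^esup>\<close>;
  this is where \<open>k \<ge> 7\<close> enters.
\<close>

section \<open>Closed walks in weighted graphs\<close>

locale weighted_graph =
  fixes Z :: "'z set" and w :: "'z \<Rightarrow> 'z \<Rightarrow> real"
  assumes fin: "finite Z"
    and nonneg: "0 \<le> w u v"
    and sym: "w u v = w v u"
begin

text \<open>For \<open>u\<close>, \<open>v\<close> in \<open>Z\<close> this is an entry of the
  \<open>n\<close>-th power of the weight matrix.\<close>

primrec wk :: "nat \<Rightarrow> 'z \<Rightarrow> 'z \<Rightarrow> real" where
  "wk 0 u v = (if u = v then 1 else 0)"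
| "wk (Suc n) u v = (\<Sum>t\<in>Z. w u t * wk n t v)"

lemma wk_nonneg: "0 \<le> wk n u v"
  by (induction n arbitrary: u) (auto intro!: sum_nonneg simp: nonneg)

lemma wk_add:
  assumes "u \<in> Z"
  shows "wk (m + n) u v = (\<Sum>t\<in>Z. wk m u t * wk n t v)"
  using assms
proof (induction m arbitrary: u)
  case 0
  have "(\<Sum>t\<in>Z. wk 0 u t * wk n t v) = (\<Sum>t\<in>Z. if t = u then wk n t v else 0)"
    by (intro sum.cong) auto
  then show ?case using 0 fin by simp
next
  case (Suc m)
  have "wk (Suc m + n) u v = (\<Sum>t\<in>Z. w u t * (\<Sum>r\<in>Z. wk m t r * wk n r v))"
    using Suc.IH by simp
  also have "\<dots> = (\<Sum>t\<in>Z. \<Sum>r\<in>Z. w u t * wk m t r * wk n r v)"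
    by (simp add: sum_distrib_left mult.assoc)
  also have "\<dots> = (\<Sum>r\<in>Z. \<Sum>t\<in>Z. w u t * wk m t r * wk n r v)"
    by (rule sum.swap)
  finally show ?case by (simp add: sum_distrib_right)
qed

lemma wk_1: "v \<in> Z \<Longrightarrow> wk (Suc 0) u v = w u v"
proof -
  assume v: "v \<in> Z"
  have "wk (Suc 0) u v = (\<Sum>t\<in>Z. if t = v then w u t else 0)"
    by (auto intro!: sum.cong)
  then show ?thesis using v fin by simp
qed

lemma wk_sym: "u \<in> Z \<Longrightarrow> v \<in> Z \<Longrightarrow> wk n u v = wk n v u"
proof (induction n arbitrary: u v)
  case (Suc n)
  have "wk (Suc n) u v = (\<Sum>t\<in>Z. w u t * wk n t v)" by simp
  also have "\<dots> = (\<Sum>t\<in>Z. wk n v t * wk (Suc 0) t u)"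
    using Suc by (intro sum.cong) (simp_all add: wk_1 sym[of u] del: wk.simps(2))
  also have "\<dots> = wk (n + Suc 0) v u"
    using Suc.prems by (intro wk_add[symmetric]) simp
  finally show ?case by simp
qed simp

text \<open>The squared Frobenius norm of the \<open>j\<close>-th matrix power. By symmetry it is
  the trace of the power \<open>2 * j\<close>, hence the total weight of the closed walks of length
  \<open>2 * j\<close>.\<close>

definition closed_wt :: "nat \<Rightarrow> real" where
  "closed_wt j = (\<Sum>u\<in>Z. \<Sum>v\<in>Z. (wk j u v)\<^sup>2)"

lemma closed_wt_nonneg: "0 \<le> closed_wt j"
  by (auto simp: closed_wt_def intro!: sum_nonneg)

lemma closed_wt_0: "closed_wt 0 = card Z"
proof -
  have "closed_wt 0 = (\<Sum>u\<in>Z. \<Sum>v\<in>Z. if v = u then 1 else 0)"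
    unfolding closed_wt_def by (intro sum.cong) auto
  then show ?thesis using fin by simp
qed

lemma sum_wk_mult: "(\<Sum>u\<in>Z. \<Sum>v\<in>Z. wk i u v * wk j u v) = (\<Sum>u\<in>Z. wk (i + j) u u)"
  by (intro sum.cong refl) (simp add: wk_add wk_sym[of _ _ j] cong: sum.cong)

lemma closed_wt_eq_trace: "closed_wt k = (\<Sum>u\<in>Z. wk (2 * k) u u)"
  using sum_wk_mult[of k k] by (simp add: closed_wt_def power2_eq_square mult_2)

lemma closed_wt_split:
  assumes "i + j = 2 * k"
  shows "closed_wt k = (\<Sum>u\<in>Z. \<Sum>v\<in>Z. wk i u v * wk j u v)"
  using sum_wk_mult[of i j] assms by (simp add: closed_wt_eq_trace)

lemma double_sum_CS:
  fixes g h :: "'a \<Rightarrow> 'b \<Rightarrow> real"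
  shows "(\<Sum>u\<in>A. \<Sum>v\<in>B. g u v * h u v)\<^sup>2 \<le>
    (\<Sum>u\<in>A. \<Sum>v\<in>B. (g u v)\<^sup>2) * (\<Sum>u\<in>A. \<Sum>v\<in>B. (h u v)\<^sup>2)"
  using Cauchy_Schwarz_ineq_sum[of "\<lambda>(u,v). g u v" "\<lambda>(u,v). h u v" "A \<times> B"]
  by (simp add: sum.cartesian_product split_def)

text \<open>Cauchy-Schwarz for the matrix powers \<open>j\<close> and \<open>j + 2\<close>, whose
  inner product is the trace of the power \<open>2 * (j + 1)\<close>.\<close>

lemma closed_wt_log_convex: "(closed_wt (Suc j))\<^sup>2 \<le> closed_wt j * closed_wt (Suc (Suc j))"
proof -
  have "closed_wt (Suc j) = (\<Sum>u\<in>Z. \<Sum>v\<in>Z. wk j u v * wk (Suc (Suc j)) u v)"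
    by (rule closed_wt_split) simp
  then show ?thesis
    by (simp add: closed_wt_def double_sum_CS del: wk.simps)
qed

text \<open>By log-convexity the ratios of consecutive values of \<open>closed_wt\<close> do not
  decrease, so a bound on the last ratio holds for all earlier ones, and the product telescopes down
  to \<open>closed_wt 0\<close>.\<close>

lemma closed_wt_le_power:
  assumes "closed_wt (Suc k) \<le> r * closed_wt k" "0 \<le> r"
  shows "closed_wt (Suc k) \<le> r ^ Suc k * card Z"
  using assms(1)
proof (induction k)
  case 0
  then show ?case by (simp add: closed_wt_0)
next
  case (Suc k)
  have "closed_wt (Suc k) \<le> r * closed_wt k"
  proof (cases "closed_wt (Suc k) = 0")
    case True
    then show ?thesis using assms(2) closed_wt_nonneg by simp
  next
    case False
    then have pos: "closed_wt (Suc k) > 0" using closed_wt_nonneg[of "Suc k"] by simp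
    have "(closed_wt (Suc k))\<^sup>2 \<le> closed_wt k * (r * closed_wt (Suc k))"
      using closed_wt_log_convex[of k] Suc.prems closed_wt_nonneg[of k]
      by (meson mult_left_mono order_trans)
    then show ?thesis using pos by (simp add: power2_eq_square mult.commute)
  qed
  then have "closed_wt (Suc k) \<le> r ^ Suc k * card Z" by (rule Suc.IH)
  then have "r * closed_wt (Suc k) \<le> r * (r ^ Suc k * card Z)"
    using assms(2) by (rule mult_left_mono)
  with Suc.prems show ?case by simp
qed

section \<open>Lower bound for closed walks by iterated row sums\<close>

definition row :: "nat \<Rightarrow> 'z \<Rightarrow> real" where
  "row j u = (\<Sum>v\<in>Z. wk j u v)"

lemma row_0: "u \<in> Z \<Longrightarrow> row 0 u = 1"
  using fin by (simp add: row_def)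

lemma row_Suc: "row (Suc j) u = (\<Sum>t\<in>Z. w u t * row j t)"
  by (simp add: row_def sum_distrib_left) (rule sum.swap)

text \<open>\<open>row j\<close> is the \<open>j\<close>-th matrix power applied to the all-ones
  vector. Symmetry moves one factor of the matrix across the inner product, leaving
  \<open>row j\<close> against \<open>row (j + 2)\<close>, to which Cauchy-Schwarz applies.\<close>

lemma row_log_convex:
  "(\<Sum>u\<in>Z. (row (Suc j) u)\<^sup>2)\<^sup>2 \<le> (\<Sum>u\<in>Z. (row j u)\<^sup>2) * (\<Sum>u\<in>Z. (row (Suc (Suc j)) u)\<^sup>2)"
proof -
  have "(\<Sum>u\<in>Z. (row (Suc j) u)\<^sup>2) = (\<Sum>u\<in>Z. row (Suc j) u * (\<Sum>t\<in>Z. w u t * row j t))"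
    by (simp add: power2_eq_square row_Suc)
  also have "\<dots> = (\<Sum>u\<in>Z. \<Sum>t\<in>Z. row j t * (w t u * row (Suc j) u))"
    by (simp add: sum_distrib_left sym[of _ u for u] mult_ac)
  also have "\<dots> = (\<Sum>t\<in>Z. row j t * row (Suc (Suc j)) t)"
    by (subst sum.swap) (simp add: sum_distrib_left row_Suc[of "Suc j"])
  finally show ?thesis using Cauchy_Schwarz_ineq_sum by metis
qed

text \<open>An eigenvalue-free form of the bound of a trace by the average row sum. Each
  multiplication by the matrix raises the squared norm of the row-sum vector by a factor of at least
  \<open>D\<^sup>2\<close>: the first time by Cauchy-Schwarz, later by log-convexity.\<close>

lemma closed_wt_ge_power:
  fixes D :: real
  assumes D: "0 \<le> D" and W: "D * card Z \<le> (\<Sum>u\<in>Z. \<Sum>v\<in>Z. w u v)" and ne: "Z \<noteq> {}"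
  shows "D ^ (2 * k) \<le> closed_wt k"
proof -
  define m where "m j = (\<Sum>u\<in>Z. (row j u)\<^sup>2)" for j
  have N: "real (card Z) > 0" using ne fin by (simp add: card_gt_0_iff)
  have m0: "m 0 = card Z" by (simp add: m_def row_0)
  have mnn: "m j \<ge> 0" for j by (simp add: m_def sum_nonneg)
  have lc: "(m (Suc j))\<^sup>2 \<le> m j * m (Suc (Suc j))" for j
    unfolding m_def by (rule row_log_convex)
  have row1: "row (Suc 0) u = (\<Sum>v\<in>Z. w u v)" if "u \<in> Z" for u
    by (simp add: row_Suc row_0)
  have "(\<Sum>u\<in>Z. row (Suc 0) u)\<^sup>2 \<le> m (Suc 0) * card Z"
    using Cauchy_Schwarz_ineq_sum[of "row (Suc 0)" "\<lambda>_. 1" Z] by (simp add: m_def)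
  moreover have "(D * card Z)\<^sup>2 \<le> (\<Sum>u\<in>Z. row (Suc 0) u)\<^sup>2"
    using W D by (intro power_mono) (simp_all add: row1)
  ultimately have "(D\<^sup>2 * card Z) * card Z \<le> m (Suc 0) * card Z"
    by (simp add: power2_eq_square mult_ac)
  then have m1: "D\<^sup>2 * m 0 \<le> m (Suc 0)"
    using N m0 by simp
  have step: "D\<^sup>2 * m j \<le> m (Suc j)" for j
  proof (induction j)
    case 0 then show ?case by (rule m1)
  next
    case (Suc j)
    show ?case
    proof (cases "m (Suc j) = 0")
      case True then show ?thesis using mnn by simp
    next
      case False
      then have p: "m (Suc j) > 0" using mnn[of "Suc j"] by simp
      then have pj: "m j > 0" using lc[of j] mnn[of j]
        by (metis less_eq_real_def mult_eq_0_iff not_le zero_less_power)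
      have "m j * (D\<^sup>2 * m (Suc j)) \<le> m (Suc j) * m (Suc j)"
        using mult_right_mono[OF Suc mnn[of "Suc j"]] by (simp add: mult_ac)
      also have "\<dots> \<le> m j * m (Suc (Suc j))" using lc[of j] by (simp add: power2_eq_square)
      finally show ?thesis using pj by simp
    qed
  qed
  have pw: "D ^ (2 * j) * card Z \<le> m j" for j
  proof (induction j)
    case (Suc j)
    have "D\<^sup>2 * (D ^ (2 * j) * card Z) \<le> D\<^sup>2 * m j"
      using Suc by (intro mult_left_mono) simp_all
    with step[of j] show ?case by (simp add: power2_eq_square)
  qed (simp add: m0)
  \<comment> \<open>Cauchy-Schwarz within each row passes from row sums to squared entries; the loss
    of \<open>card Z\<close> cancels against the factor \<open>card Z\<close> in
    \<open>pw\<close>.\<close>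
  have "m k \<le> (\<Sum>u\<in>Z. card Z * (\<Sum>v\<in>Z. (wk k u v)\<^sup>2))"
    unfolding m_def
  proof (rule sum_mono)
    fix u show "(row k u)\<^sup>2 \<le> card Z * (\<Sum>v\<in>Z. (wk k u v)\<^sup>2)"
      using Cauchy_Schwarz_ineq_sum[of "wk k u" "\<lambda>_. 1" Z] by (simp add: row_def mult.commute)
  qed
  then have "m k \<le> card Z * closed_wt k" by (simp add: closed_wt_def sum_distrib_left)
  with pw[of k] have "card Z * D ^ (2 * k) \<le> card Z * closed_wt k" by (simp add: mult.commute)
  then show ?thesis using N by simp
qed

text \<open>
  The total weight of the closed walks of length \<open>m + n\<close> whose vertices at positions \<open>0\<close> and \<open>m\<close> are
  related by \<open>R\<close>.
\<close>

definition marked_wt :: "('z \<Rightarrow> 'z \<Rightarrow> bool) \<Rightarrow> nat \<Rightarrow> nat \<Rightarrow> real" where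
  "marked_wt R m n = (\<Sum>a\<in>Z. \<Sum>c\<in>Z. of_bool (R a c) * (wk m a c * wk n c a))"

lemma marked_wt_commute: "marked_wt R m n = marked_wt R n m"
  unfolding marked_wt_def
  by (intro sum.cong refl) (metis (no_types) mult.commute wk_sym)

text \<open>The closed walk is cut into the step from \<open>a\<close> to \<open>u\<close>, then
  \<open>k - 1\<close> steps through \<open>c\<close> to \<open>b\<close>, then \<open>k\<close>
  steps back to \<open>a\<close>. Cauchy-Schwarz over \<open>(a, u, b)\<close> with the weight
  \<open>w a u\<close> separates the marked part, where summing over \<open>a\<close> gives
  \<open>s\<close>, from the unmarked part, where summing over \<open>u\<close> gives
  \<open>D\<close>.\<close>

lemma marked_wt_bound_aux:
  assumes m: "0 < m" "m \<le> k"
    and s: "\<And>u c. u \<in> Z \<Longrightarrow> c \<in> Z \<Longrightarrow> (\<Sum>a\<in>Z. of_bool (R a c) * w a u) \<le> s"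
    and D: "\<And>u. u \<in> Z \<Longrightarrow> (\<Sum>a\<in>Z. w a u) \<le> D"
  shows "(marked_wt R m (2 * k - m))\<^sup>2 \<le> s * D * closed_wt k * closed_wt (k - 1)"
proof -
  \<comment> \<open>The weight of the walks of length \<open>k - 1\<close> from \<open>u\<close> to
    \<open>b\<close> whose vertex \<open>c\<close> at position \<open>m - 1\<close> satisfies
    \<open>R a c\<close>.\<close>
  define be where "be a u b = (\<Sum>c\<in>Z. of_bool (R a c) * (wk (m - 1) u c * wk (k - m) c b))" for a u b
  have wkk: "wk (k - 1) u b = (\<Sum>c\<in>Z. wk (m - 1) u c * wk (k - m) c b)" if "u \<in> Z" for u b
    using wk_add[OF that, of "m - 1" "k - m"] m by simp
  have be0: "0 \<le> be a u b" for a u b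
    unfolding be_def by (intro sum_nonneg mult_nonneg_nonneg) (simp_all add: wk_nonneg)
  have be1: "be a u b \<le> wk (k - 1) u b" if "u \<in> Z" for a u b
    unfolding be_def wkk[OF that]
    by (intro sum_mono) (simp add: wk_nonneg)
  have bes: "(\<Sum>a\<in>Z. w a u * be a u b) \<le> s * wk (k - 1) u b" if "u \<in> Z" for u b
  proof -
    have "(\<Sum>a\<in>Z. w a u * be a u b) =
      (\<Sum>c\<in>Z. (\<Sum>a\<in>Z. of_bool (R a c) * w a u) * (wk (m - 1) u c * wk (k - m) c b))"
      unfolding be_def sum_distrib_left sum_distrib_right
      by (subst sum.swap) (simp add: mult_ac)
    also have "\<dots> \<le> (\<Sum>c\<in>Z. s * (wk (m - 1) u c * wk (k - m) c b))"
      using s that by (intro sum_mono mult_right_mono) (simp_all add: wk_nonneg)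
    finally show ?thesis by (simp only: wkk[OF that] sum_distrib_left)
  qed
  have "marked_wt R m (2 * k - m) =
    (\<Sum>a\<in>Z. \<Sum>c\<in>Z. of_bool (R a c) * ((\<Sum>u\<in>Z. w a u * wk (m - 1) u c) * (\<Sum>b\<in>Z. wk (k - m) c b * wk k b a)))"
    unfolding marked_wt_def
  proof (intro sum.cong refl, goal_cases)
    case (1 a c)
    have "wk m a c = (\<Sum>u\<in>Z. w a u * wk (m - 1) u c)"
      using m by (cases m) simp_all
    moreover have "wk (2 * k - m) c a = (\<Sum>b\<in>Z. wk (k - m) c b * wk k b a)"
      using wk_add[OF 1(2), of "k - m" k] m by (simp add: mult_2)
    ultimately show ?case by simp
  qed
  also have "\<dots> = (\<Sum>a\<in>Z. \<Sum>c\<in>Z. \<Sum>u\<in>Z. \<Sum>b\<in>Z.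
      w a u * (of_bool (R a c) * (wk (m - 1) u c * wk (k - m) c b)) * wk k b a)"
    by (intro sum.cong refl, simp only: sum_product, simp only: sum_distrib_left mult_ac)
  also have "\<dots> = (\<Sum>a\<in>Z. \<Sum>u\<in>Z. \<Sum>b\<in>Z. \<Sum>c\<in>Z.
      w a u * (of_bool (R a c) * (wk (m - 1) u c * wk (k - m) c b)) * wk k b a)"
    by (rule sum.cong[OF refl], rule trans[OF sum.swap], rule sum.cong[OF refl], rule sum.swap)
  also have "\<dots> = (\<Sum>a\<in>Z. \<Sum>u\<in>Z. \<Sum>b\<in>Z. w a u * be a u b * wk k b a)"
    by (simp add: be_def sum_distrib_left sum_distrib_right)
  also have "\<dots> = (\<Sum>(a,u,b)\<in>Z\<times>Z\<times>Z. (sqrt (w a u) * be a u b) * (sqrt (w a u) * wk k b a))"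
  proof -
    have "w a u * be a u b * wk k b a = (sqrt (w a u) * be a u b) * (sqrt (w a u) * wk k b a)" for a u b
      using real_sqrt_mult_self[of "w a u"] nonneg[of a u] by (simp add: algebra_simps)
    then show ?thesis by (simp only: sum.cartesian_product case_prod_conv split_def)
  qed
  finally have "(marked_wt R m (2 * k - m))\<^sup>2 \<le>
    (\<Sum>(a,u,b)\<in>Z\<times>Z\<times>Z. (sqrt (w a u) * be a u b)\<^sup>2) * (\<Sum>(a,u,b)\<in>Z\<times>Z\<times>Z. (sqrt (w a u) * wk k b a)\<^sup>2)"
    using Cauchy_Schwarz_ineq_sum[of "\<lambda>(a,u,b). sqrt (w a u) * be a u b" "\<lambda>(a,u,b). sqrt (w a u) * wk k b a" "Z\<times>Z\<times>Z"]
    by (simp add: split_def)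
  also have "(\<Sum>(a,u,b)\<in>Z\<times>Z\<times>Z. (sqrt (w a u) * be a u b)\<^sup>2) =
      (\<Sum>u\<in>Z. \<Sum>b\<in>Z. \<Sum>a\<in>Z. w a u * (be a u b)\<^sup>2)" (is "?L = _")
  proof -
    have "?L = (\<Sum>a\<in>Z. \<Sum>u\<in>Z. \<Sum>b\<in>Z. w a u * (be a u b)\<^sup>2)"
      by (simp add: sum.cartesian_product[symmetric] power_mult_distrib nonneg)
    also have "\<dots> = (\<Sum>u\<in>Z. \<Sum>b\<in>Z. \<Sum>a\<in>Z. w a u * (be a u b)\<^sup>2)"
      by (rule trans[OF sum.swap], rule sum.cong[OF refl], rule sum.swap)
    finally show ?thesis .
  qed
  also have "(\<Sum>(a,u,b)\<in>Z\<times>Z\<times>Z. (sqrt (w a u) * wk k b a)\<^sup>2) =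
      (\<Sum>b\<in>Z. \<Sum>a\<in>Z. (\<Sum>u\<in>Z. w u a) * (wk k b a)\<^sup>2)" (is "?L = _")
  proof -
    have "?L = (\<Sum>a\<in>Z. \<Sum>u\<in>Z. \<Sum>b\<in>Z. w u a * (wk k b a)\<^sup>2)"
      by (simp add: sum.cartesian_product[symmetric] power_mult_distrib nonneg sym)
    also have "\<dots> = (\<Sum>a\<in>Z. \<Sum>b\<in>Z. \<Sum>u\<in>Z. w u a * (wk k b a)\<^sup>2)"
      by (rule sum.cong[OF refl], rule sum.swap)
    also have "\<dots> = (\<Sum>b\<in>Z. \<Sum>a\<in>Z. \<Sum>u\<in>Z. w u a * (wk k b a)\<^sup>2)"
      by (rule sum.swap)
    finally show ?thesis by (simp add: sum_distrib_right)
  qed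
  also have "(\<Sum>u\<in>Z. \<Sum>b\<in>Z. \<Sum>a\<in>Z. w a u * (be a u b)\<^sup>2) *
      (\<Sum>b\<in>Z. \<Sum>a\<in>Z. (\<Sum>u\<in>Z. w u a) * (wk k b a)\<^sup>2) \<le>
      (s * closed_wt (k - 1)) * (D * closed_wt k)"
  proof (rule mult_mono)
    \<comment> \<open>One factor of \<open>be\<close> is replaced by the unrestricted
      \<open>wk (k - 1) u b\<close>; the other keeps the restriction, so that \<open>bes\<close>
      applies.\<close>
    have "(\<Sum>a\<in>Z. w a u * (be a u b)\<^sup>2) \<le> s * (wk (k - 1) u b)\<^sup>2" if u: "u \<in> Z" for u b
    proof -
      have "(\<Sum>a\<in>Z. w a u * (be a u b)\<^sup>2) \<le> (\<Sum>a\<in>Z. w a u * be a u b * wk (k - 1) u b)"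
        unfolding power2_eq_square mult.assoc using be0 be1[OF u] nonneg
        by (intro sum_mono mult_left_mono) simp_all
      also have "\<dots> = (\<Sum>a\<in>Z. w a u * be a u b) * wk (k - 1) u b"
        by (simp add: sum_distrib_right)
      also have "\<dots> \<le> s * wk (k - 1) u b * wk (k - 1) u b"
        using bes[OF u] by (intro mult_right_mono) (simp_all add: wk_nonneg)
      finally show ?thesis by (simp add: power2_eq_square mult.assoc)
    qed
    then show "(\<Sum>u\<in>Z. \<Sum>b\<in>Z. \<Sum>a\<in>Z. w a u * (be a u b)\<^sup>2) \<le> s * closed_wt (k - 1)"
      unfolding closed_wt_def sum_distrib_left by (intro sum_mono)
    show "(\<Sum>b\<in>Z. \<Sum>a\<in>Z. (\<Sum>u\<in>Z. w u a) * (wk k b a)\<^sup>2) \<le> D * closed_wt k"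
      unfolding closed_wt_def sum_distrib_left using D
      by (intro sum_mono mult_right_mono) simp_all
    show "0 \<le> (\<Sum>b\<in>Z. \<Sum>a\<in>Z. (\<Sum>u\<in>Z. w u a) * (wk k b a)\<^sup>2)"
      by (intro sum_nonneg mult_nonneg_nonneg) (simp_all add: nonneg)
    \<comment> \<open>The hypotheses force \<open>s\<close> to be nonnegative only for nonempty
      \<open>Z\<close>; for empty \<open>Z\<close> the walk weight vanishes.\<close>
    have "0 \<le> s" if "z \<in> Z" for z
      using s[OF that that] sum_nonneg[of Z "\<lambda>a. of_bool (R a z) * w a z"] nonneg by simp
    moreover have "closed_wt (k - 1) = 0" if "Z = {}"
      unfolding closed_wt_def by (simp add: that)
    ultimately show "0 \<le> s * closed_wt (k - 1)"
      using closed_wt_nonneg[of "k - 1"] by (metis ex_in_conv mult_nonneg_nonneg mult_zero_right order_refl)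
  qed
  finally show ?thesis by (simp add: mult_ac)
qed

text \<open>One of the two arcs between the marked positions has length at most \<open>k\<close>;
  \<open>marked_wt_commute\<close> makes it the first.\<close>

lemma marked_wt_bound:
  assumes m: "0 < m" "m < 2 * k"
    and s: "\<And>u c. u \<in> Z \<Longrightarrow> c \<in> Z \<Longrightarrow> (\<Sum>a\<in>Z. of_bool (R a c) * w a u) \<le> s"
    and D: "\<And>u. u \<in> Z \<Longrightarrow> (\<Sum>a\<in>Z. w a u) \<le> D"
  shows "(marked_wt R m (2 * k - m))\<^sup>2 \<le> s * D * closed_wt k * closed_wt (k - 1)"
proof (cases "m \<le> k")
  case True
  then show ?thesis using marked_wt_bound_aux[OF m(1) _ s D] by simp
next
  case False
  then show ?thesis
    using marked_wt_bound_aux[where m = "2 * k - m" and k = k and R = R, OF _ _ s D] m marked_wt_commute[of R m "2 * k - m"]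
    by simp
qed

end

section \<open>Closed walks as lists\<close>

context weighted_graph
begin

definition tuples :: "nat \<Rightarrow> 'z list set" where
  "tuples n = {xs. set xs \<subseteq> Z \<and> length xs = n}"

lemma sum_tuples_0: "(\<Sum>xs\<in>tuples 0. g xs) = g []"
proof -
  have "tuples 0 = {[]}" by (auto simp: tuples_def)
  then show ?thesis by simp
qed

lemma sum_tuples_Suc: "(\<Sum>xs\<in>tuples (Suc n). g xs) = (\<Sum>x\<in>Z. \<Sum>xs\<in>tuples n. g (x # xs))"
proof -
  have "(\<Sum>xs\<in>tuples (Suc n). g xs) = (\<Sum>(x, xs)\<in>Z \<times> tuples n. g (x # xs))"
    by (rule sum.reindex_bij_witness[of _ "\<lambda>(x, xs). x # xs" "\<lambda>xs. (hd xs, tl xs)"])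
      (auto simp: tuples_def length_Suc_conv)
  then show ?thesis by (simp add: sum.cartesian_product)
qed

lemma sum_tuples_add:
  "(\<Sum>xs\<in>tuples (m + n). g xs) = (\<Sum>ys\<in>tuples m. \<Sum>zs\<in>tuples n. g (ys @ zs))"
  by (induction m arbitrary: g) (simp_all add: sum_tuples_0 sum_tuples_Suc)

fun path_wt :: "'z list \<Rightarrow> real" where
  "path_wt (x # y # zs) = w x y * path_wt (y # zs)"
| "path_wt [x] = 1"
| "path_wt [] = 1"

lemma path_wt_append: "path_wt (xs @ c # ys) = path_wt (xs @ [c]) * path_wt (c # ys)"
  by (induction xs rule: induct_list012) simp_all

lemma path_wt_nonneg: "0 \<le> path_wt xs"
  by (induction xs rule: path_wt.induct) (simp_all add: nonneg)

lemma path_wt_pos: "0 < path_wt xs \<Longrightarrow> Suc i < length xs \<Longrightarrow> 0 < w (xs ! i) (xs ! Suc i)"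
proof (induction xs arbitrary: i rule: path_wt.induct)
  case (1 x y zs)
  then have "0 < w x y" "0 < path_wt (y # zs)"
    using nonneg[of x y] path_wt_nonneg[of "y # zs"] by (auto simp: zero_less_mult_iff)
  with 1 show ?case by (cases i) auto
qed simp_all

lemma wk_eq_sum_path_wt: "v \<in> Z \<Longrightarrow> wk (Suc n) u v = (\<Sum>xs\<in>tuples n. path_wt (u # xs @ [v]))"
proof (induction n arbitrary: u)
  case 0
  then show ?case by (simp add: sum_tuples_0 wk_1 del: wk.simps(2))
next
  case (Suc n)
  have "wk (Suc (Suc n)) u v = (\<Sum>t\<in>Z. w u t * wk (Suc n) t v)" by simp
  then show ?case using Suc by (simp add: sum_tuples_Suc sum_distrib_left del: wk.simps(2))
qed

definition cycle_wt :: "'z list \<Rightarrow> real" where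
  "cycle_wt xs = path_wt (xs @ [hd xs])"

lemma cycle_wt_nonneg: "0 \<le> cycle_wt xs"
  by (simp add: cycle_wt_def path_wt_nonneg)

lemma cycle_wt_rotate1: "cycle_wt (rotate1 xs) = cycle_wt xs"
proof (cases xs rule: path_wt.cases)
  case (1 x y zs)
  then show ?thesis
    using path_wt_append[of "y # zs" x "[y]"] by (simp add: cycle_wt_def)
qed (simp_all add: cycle_wt_def)

lemma cycle_wt_rotate: "cycle_wt (rotate i xs) = cycle_wt xs"
  by (induction i) (simp_all add: cycle_wt_rotate1)

lemma cycle_wt_pos:
  assumes "0 < cycle_wt xs" "i < length xs"
  shows "0 < w (xs ! i) (xs ! (Suc i mod length xs))"
proof (cases "Suc i = length xs")
  case True
  then have "xs \<noteq> []" by auto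
  then show ?thesis
    using path_wt_pos[of "xs @ [hd xs]" i] assms True
    by (simp add: cycle_wt_def nth_append hd_conv_nth)
next
  case False
  then show ?thesis
    using path_wt_pos[of "xs @ [hd xs]" i] assms by (simp add: cycle_wt_def nth_append)
qed

lemma closed_wt_eq_sum_cycle_wt:
  assumes "0 < k"
  shows "closed_wt k = (\<Sum>xs\<in>tuples (2 * k). cycle_wt xs)"
proof -
  obtain n where n: "2 * k = Suc n" using assms by (cases "2 * k") auto
  have "closed_wt k = (\<Sum>a\<in>Z. wk (Suc n) a a)"
    by (simp add: closed_wt_eq_trace n)
  also have "\<dots> = (\<Sum>a\<in>Z. \<Sum>xs\<in>tuples n. path_wt (a # xs @ [a]))"
    by (intro sum.cong refl) (rule wk_eq_sum_path_wt)
  finally show ?thesis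
    unfolding n by (simp add: sum_tuples_Suc cycle_wt_def)
qed

lemma marked_wt_eq_sum_cycle_wt:
  assumes "0 < m" "m < n"
  shows "(\<Sum>xs\<in>tuples n. of_bool (R (xs ! 0) (xs ! m)) * cycle_wt xs) = marked_wt R m (n - m)"
proof -
  obtain m' where m': "m = Suc m'" using assms by (cases m) auto
  obtain n' where n': "n - m = Suc n'" using assms by (cases "n - m") auto
  have n: "n = Suc (m' + Suc n')" using m' n' assms by simp
  have "(\<Sum>xs\<in>tuples n. of_bool (R (xs ! 0) (xs ! m)) * cycle_wt xs) =
    (\<Sum>a\<in>Z. \<Sum>ys\<in>tuples m'. \<Sum>c\<in>Z. \<Sum>zs\<in>tuples n'.
       of_bool (R a c) * (path_wt (a # ys @ [c]) * path_wt (c # zs @ [a])))"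
    unfolding n sum_tuples_Suc sum_tuples_add
  proof (intro sum.cong refl, goal_cases)
    case (1 a ys c zs)
    then have "length ys = m'" by (simp add: tuples_def)
    then show ?case
      using path_wt_append[of "a # ys" c "zs @ [a]"] by (simp add: m' cycle_wt_def nth_append)
  qed
  also have "\<dots> = (\<Sum>a\<in>Z. \<Sum>c\<in>Z. of_bool (R a c) *
      ((\<Sum>ys\<in>tuples m'. path_wt (a # ys @ [c])) * (\<Sum>zs\<in>tuples n'. path_wt (c # zs @ [a]))))"
    by (rule sum.cong[OF refl], rule trans[OF sum.swap], rule sum.cong[OF refl],
        simp only: sum_product, simp only: sum_distrib_left)
  also have "\<dots> = marked_wt R m (n - m)"
    unfolding marked_wt_def m' n'[unfolded m']
    by (intro sum.cong refl) (simp only: wk_eq_sum_path_wt)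
  finally show ?thesis .
qed

lemma marked_wt_eq_sum_cycle_wt_rotated:
  assumes "i < n" "j < n" "i \<noteq> j"
  obtains m where "0 < m" "m < n"
    "(\<Sum>xs\<in>tuples n. of_bool (R (xs ! i) (xs ! j)) * cycle_wt xs) = marked_wt R m (n - m)"
proof
  \<comment> \<open>The cyclic distance from \<open>i\<close> to \<open>j\<close>: rotating by
    \<open>i\<close> moves the marked positions to \<open>0\<close> and \<open>m\<close>.\<close>
  define m where "m = (if i < j then j - i else n - i + j)"
  show m: "0 < m" "m < n" using assms by (auto simp: m_def)
  have ij: "(i + m) mod n = j"
    using assms by (auto simp: m_def)
  have "(\<Sum>xs\<in>tuples n. of_bool (R (xs ! i) (xs ! j)) * cycle_wt xs) =
    (\<Sum>xs\<in>tuples n. of_bool (R (xs ! 0) (xs ! m)) * cycle_wt xs)"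
  proof (rule sum.reindex_bij_witness[of _ "rotate (n - i)" "rotate i"])
    fix xs assume xs: "xs \<in> tuples n"
    then have len: "length xs = n" by (simp add: tuples_def)
    show "rotate (n - i) (rotate i xs) = xs" "rotate i (rotate (n - i) xs) = xs"
      using assms len by (simp_all add: rotate_rotate rotate_id)
    show "rotate i xs \<in> tuples n" "rotate (n - i) xs \<in> tuples n"
      using xs by (simp_all add: tuples_def)
    show "of_bool (R (rotate i xs ! 0) (rotate i xs ! m)) * cycle_wt (rotate i xs) =
        of_bool (R (xs ! i) (xs ! j)) * cycle_wt xs"
      using assms len m ij by (simp add: cycle_wt_rotate nth_rotate)
  qed
  then show "(\<Sum>xs\<in>tuples n. of_bool (R (xs ! i) (xs ! j)) * cycle_wt xs) = marked_wt R m (n - m)"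
    using marked_wt_eq_sum_cycle_wt[OF m] by simp
qed

text \<open>In the application \<open>S\<close> yields the two ends of a rung, so disjointness
  concerns vertices of the host graph and not merely elements of \<open>Z\<close>.\<close>

definition disjoint_cycle :: "('z \<Rightarrow> 'v set) \<Rightarrow> nat \<Rightarrow> 'z list \<Rightarrow> bool" where
  "disjoint_cycle S n xs \<longleftrightarrow> length xs = n \<and> set xs \<subseteq> Z \<and>
     (\<forall>i<n. 0 < w (xs ! i) (xs ! (Suc i mod n))) \<and>
     (\<forall>i<n. \<forall>j<n. i \<noteq> j \<longrightarrow> S (xs ! i) \<inter> S (xs ! j) = {})"

text \<open>
  For each \<open>z\<close> fix one disjoint cycle \<open>F z\<close> through \<open>z\<close>. If no two cycles as claimed exist, then every
  closed walk of positive weight meets itself or meets \<open>F z\<close>, \<open>z\<close> being its first vertex, outside \<open>z\<close>;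
  both cases are instances of the relation \<open>R\<close>.
\<close>

lemma two_disjoint_cycles:
  fixes S :: "'z \<Rightarrow> 'v set"
  assumes k: "0 < k"
    and S: "\<And>z. z \<in> Z \<Longrightarrow> finite (S z)" "\<And>z. z \<in> Z \<Longrightarrow> card (S z) \<le> 2"
    and s: "\<And>u v. u \<in> Z \<Longrightarrow> (\<Sum>a\<in>Z. of_bool (v \<in> S a) * w a u) \<le> s"
    and D: "\<And>u. u \<in> Z \<Longrightarrow> (\<Sum>a\<in>Z. w a u) \<le> D"
    and big: "64 * k ^ 5 * s * D * closed_wt (k - 1) < closed_wt k"
  shows "\<exists>xs ys. disjoint_cycle S (2 * k) xs \<and> disjoint_cycle S (2 * k) ys \<and> xs ! 0 = ys ! 0 \<and>
    (\<forall>i<2*k. \<forall>j<2*k. 0 < i \<longrightarrow> 0 < j \<longrightarrow> S (xs ! i) \<inter> S (ys ! j) = {})"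
proof (rule ccontr)
  assume none: "\<not> ?thesis"
  define n where "n = 2 * k"
  define F where "F z = (SOME xs. disjoint_cycle S n xs \<and> xs ! 0 = z)" for z
  \<comment> \<open>The vertices that the chosen cycle uses beyond its first rung; empty if no
    disjoint cycle starts at \<open>z\<close>.\<close>
  define V where "V z = (if \<exists>xs. disjoint_cycle S n xs \<and> xs ! 0 = z
      then (\<Union>i\<in>{1..<n}. S (F z ! i)) else {})" for z
  define R where "R a c \<longleftrightarrow> S a \<inter> (S c \<union> V c) \<noteq> {}" for a c
  have F: "disjoint_cycle S n (F z)" "F z ! 0 = z" if "disjoint_cycle S n xs" "xs ! 0 = z" for xs z
    using someI[of "\<lambda>xs. disjoint_cycle S n xs \<and> xs ! 0 = z" xs] that by (auto simp: F_def)
  have V: "finite (V z) \<and> card (V z) \<le> 2 * (n - 1)" for z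
  proof (cases "\<exists>xs. disjoint_cycle S n xs \<and> xs ! 0 = z")
    case True
    then have "disjoint_cycle S n (F z)" using F by blast
    then have inZ: "F z ! i \<in> Z" if "i \<in> {1..<n}" for i
      using that by (auto simp: disjoint_cycle_def)
    have "card (\<Union>i\<in>{1..<n}. S (F z ! i)) \<le> (\<Sum>i\<in>{1..<n}. card (S (F z ! i)))"
      by (rule card_UN_le) simp
    also have "\<dots> \<le> (\<Sum>i\<in>{1..<n}. 2)"
      using inZ S(2) by (intro sum_mono) blast
    finally show ?thesis using True inZ S(1) by (auto simp: V_def)
  qed (auto simp: V_def)
  have "Z \<noteq> {}" using big by (auto simp: closed_wt_def)
  then obtain z where z: "z \<in> Z" by blast
  have D0: "0 \<le> D" using D[OF z] sum_nonneg[of Z "\<lambda>a. w a z"] nonneg by simp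
  \<comment> \<open>\<open>undefined\<close> stands for an arbitrary vertex: \<open>s\<close> bounds
    a nonnegative sum for each of them.\<close>
  have s0: "0 \<le> s"
    using s[OF z, of undefined] sum_nonneg[of Z "\<lambda>a. of_bool (undefined \<in> S a) * w a z"] nonneg
    by simp
  \<comment> \<open>\<open>R a c\<close> puts into \<open>S a\<close> one of at most
    \<open>2 + 2 * (2 * k - 1) = 4 * k\<close> vertices, and each of them contributes at most
    \<open>s\<close>.\<close>
  have Rs: "(\<Sum>a\<in>Z. of_bool (R a c) * w a u) \<le> (4 * k) * s" if "u \<in> Z" "c \<in> Z" for u c
  proof -
    have fin: "finite (S c \<union> V c)" using S(1)[OF that(2)] V[of c] by blast
    have "card (S c \<union> V c) \<le> 2 + 2 * (n - 1)"
      using card_Un_le[of "S c" "V c"] S(2)[OF that(2)] V[of c] by linarith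
    then have card: "card (S c \<union> V c) \<le> 4 * k" using k by (simp add: n_def)
    have "(\<Sum>a\<in>Z. of_bool (R a c) * w a u) \<le> (\<Sum>a\<in>Z. (\<Sum>v\<in>S c \<union> V c. of_bool (v \<in> S a) * w a u))"
    proof (rule sum_mono)
      fix a
      show "of_bool (R a c) * w a u \<le> (\<Sum>v\<in>S c \<union> V c. of_bool (v \<in> S a) * w a u)"
      proof (cases "R a c")
        case True
        then obtain v where v: "v \<in> S c \<union> V c" "v \<in> S a" by (auto simp: R_def)
        have "of_bool (v \<in> S a) * w a u \<le> (\<Sum>v\<in>S c \<union> V c. of_bool (v \<in> S a) * w a u)"
          by (rule member_le_sum[OF v(1) _ fin]) (simp add: nonneg)
        then show ?thesis using v True by simp
      qed (simp add: sum_nonneg nonneg)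
    qed
    also have "\<dots> = (\<Sum>v\<in>S c \<union> V c. \<Sum>a\<in>Z. of_bool (v \<in> S a) * w a u)" by (rule sum.swap)
    also have "\<dots> \<le> (\<Sum>v\<in>S c \<union> V c. s)" by (intro sum_mono s that)
    also have "\<dots> \<le> (4 * k) * s" using card s0 by (simp add: mult_right_mono)
    finally show ?thesis .
  qed
  define X where "X = 4 * k * s * D * closed_wt k * closed_wt (k - 1)"
  \<comment> \<open>A walk without related positions would be a disjoint cycle and, together with
    the cycle chosen for its first vertex, the excluded pair.\<close>
  have cover: "\<exists>i<n. \<exists>j<n. i \<noteq> j \<and> R (xs ! i) (xs ! j)" if xs: "xs \<in> tuples n" and pos: "0 < cycle_wt xs" for xs
  proof (rule ccontr)
    assume no: "\<not> ?thesis"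
    have "disjoint_cycle S n xs"
      using no xs cycle_wt_pos[OF pos] unfolding disjoint_cycle_def tuples_def R_def by blast
    moreover from F[OF this refl] have "disjoint_cycle S n (F (xs ! 0))" "F (xs ! 0) ! 0 = xs ! 0" by auto
    moreover have "S (xs ! i) \<inter> S (F (xs ! 0) ! j) = {}" if "i < n" "j < n" "0 < i" "0 < j" for i j
    proof -
      have "\<not> R (xs ! i) (xs ! 0)" using no that by (metis less_nat_zero_code nat_neq_iff order.strict_trans)
      moreover have "S (F (xs ! 0) ! j) \<subseteq> V (xs ! 0)"
        using that(2,4) \<open>disjoint_cycle S n xs\<close> by (auto simp: V_def intro!: bexI[of _ j])
      ultimately show ?thesis by (auto simp: R_def)
    qed
    ultimately show False using none unfolding n_def[symmetric] by metis
  qed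
  define I where "I = {(i, j). i < n \<and> j < n \<and> i \<noteq> j}"
  have Isub: "I \<subseteq> {..<n} \<times> {..<n}" by (auto simp: I_def)
  then have finI: "finite I" by (rule finite_subset) simp
  have cardI: "card I \<le> n * n" using card_mono[OF _ Isub] by simp
  have "closed_wt k = (\<Sum>xs\<in>tuples n. cycle_wt xs)"
    unfolding n_def using k by (rule closed_wt_eq_sum_cycle_wt)
  also have "\<dots> \<le> (\<Sum>xs\<in>tuples n. \<Sum>(i, j)\<in>I. of_bool (R (xs ! i) (xs ! j)) * cycle_wt xs)"
  proof (rule sum_mono)
    fix xs assume xs: "xs \<in> tuples n"
    have nn: "0 \<le> (case p of (i, j) \<Rightarrow> of_bool (R (xs ! i) (xs ! j)) * cycle_wt xs)" for p
      by (simp add: split_def cycle_wt_nonneg)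
    show "cycle_wt xs \<le> (\<Sum>(i, j)\<in>I. of_bool (R (xs ! i) (xs ! j)) * cycle_wt xs)"
    proof (cases "0 < cycle_wt xs")
      case True
      then obtain i j where ij: "(i, j) \<in> I" "R (xs ! i) (xs ! j)"
        using cover[OF xs] by (auto simp: I_def)
      show ?thesis using member_le_sum[OF ij(1) _ finI, of "\<lambda>(i, j). of_bool (R (xs ! i) (xs ! j)) * cycle_wt xs"] nn ij(2)
        by simp
    next
      case False
      then show ?thesis using sum_nonneg[of I "\<lambda>p. case p of (i, j) \<Rightarrow> of_bool (R (xs ! i) (xs ! j)) * cycle_wt xs"] nn by simp
    qed
  qed
  also have "\<dots> = (\<Sum>(i, j)\<in>I. \<Sum>xs\<in>tuples n. of_bool (R (xs ! i) (xs ! j)) * cycle_wt xs)"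
    by (simp only: split_def) (rule sum.swap)
  also have "\<dots> \<le> (\<Sum>p\<in>I. sqrt X)"
  proof (rule sum_mono, clarify)
    fix i j assume "(i, j) \<in> I"
    then have "i < n" "j < n" "i \<noteq> j" by (auto simp: I_def)
    then obtain m where m: "0 < m" "m < n"
      "(\<Sum>xs\<in>tuples n. of_bool (R (xs ! i) (xs ! j)) * cycle_wt xs) = marked_wt R m (n - m)"
      using marked_wt_eq_sum_cycle_wt_rotated[of i n j R] by blast
    have "(marked_wt R m (2 * k - m))\<^sup>2 \<le> (4 * k * s) * D * closed_wt k * closed_wt (k - 1)"
      using m by (intro marked_wt_bound[OF _ _ Rs D]) (simp_all add: n_def)
    then have "marked_wt R m (n - m) \<le> sqrt X"
      unfolding X_def n_def by (intro real_le_rsqrt) (simp add: mult.assoc)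
    then show "(\<Sum>xs\<in>tuples n. of_bool (R (xs ! i) (xs ! j)) * cycle_wt xs) \<le> sqrt X"
      using m(3) by simp
  qed
  also have "\<dots> \<le> (2 * k)\<^sup>2 * sqrt X"
  proof -
    have "0 \<le> X" using s0 D0 by (simp add: X_def closed_wt_nonneg)
    then show ?thesis using cardI
      by (simp add: n_def power2_eq_square mult_right_mono flip: of_nat_mult)
  qed
  finally have le: "closed_wt k \<le> (2 * k)\<^sup>2 * sqrt X" .
  have "0 \<le> 64 * real k ^ 5 * s * D * closed_wt (k - 1)" using s0 D0 by (simp add: closed_wt_nonneg)
  then have pos: "0 < closed_wt k" using big by (rule le_less_trans)
  have X0: "X \<ge> 0" using s0 D0 by (simp add: X_def closed_wt_nonneg)
  \<comment> \<open>Squaring turns the number \<open>(2 * k)\<^sup>2\<close> of pairs of positions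
    into \<open>16 * k ^ 4\<close>; the factor \<open>4 * k\<close> in \<open>X\<close> completes
    the constant \<open>64 * k ^ 5\<close>.\<close>
  have "(closed_wt k)\<^sup>2 \<le> ((2 * k)\<^sup>2 * sqrt X)\<^sup>2"
    using le pos by (intro power_mono) simp_all
  then have "closed_wt k * closed_wt k \<le> (64 * k ^ 5 * s * D * closed_wt (k - 1)) * closed_wt k"
    using X0 by (simp add: power_mult_distrib real_sqrt_pow2)
      (simp add: X_def power2_eq_square eval_nat_numeral algebra_simps)
  then show False using big pos by (simp add: mult_le_cancel_right)
qed

end

section \<open>The auxiliary graph on the edges of a bipartite pair\<close>

lemma sum_of_bool_card: "finite A \<Longrightarrow> (\<Sum>x\<in>A. of_bool (P x)) = real (card {x \<in> A. P x})"
  by (simp add: sum_of_bool_eq Int_def)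

text \<open>\<open>P\<close> serves as a lower threshold for codegrees of pairs in \<open>A\<close>,
  \<open>Q\<close> as an upper threshold for codegrees of pairs in \<open>B\<close>. The two sets
  may overlap: distinct rungs are kept apart by \<open>disjoint_cycle\<close>, and the two ends of a
  rung by irreflexivity of the host graph.\<close>

locale bipartite_pair =
  fixes adj :: "'v \<Rightarrow> 'v \<Rightarrow> bool" and A B :: "'v set" and P Q :: real
  assumes finA: "finite A" and finB: "finite B"
    and adj_sym: "adj x y \<Longrightarrow> adj y x"
    and P_pos: "0 < P" and Q_nonneg: "0 \<le> Q"
begin

definition nbrs :: "'v \<Rightarrow> 'v set" where "nbrs b = {x \<in> A. adj x b}"
definition comB :: "'v \<Rightarrow> 'v \<Rightarrow> 'v set" where "comB x y = {b \<in> B. adj x b \<and> adj y b}"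
definition comA :: "'v \<Rightarrow> 'v \<Rightarrow> 'v set" where "comA b c = {x \<in> A. adj x b \<and> adj x c}"
definition p :: "'v \<Rightarrow> 'v \<Rightarrow> real" where "p x y = card (comB x y)"
definition q :: "'v \<Rightarrow> 'v \<Rightarrow> real" where "q b c = card (comA b c)"
definition rungs :: "('v \<times> 'v) set" where "rungs = {(x, b) \<in> A \<times> B. adj x b}"

text \<open>Degenerate steps with \<open>x = y\<close> or \<open>b = c\<close> are allowed; they satisfy the same bounds.\<close>

definition step :: "'v \<Rightarrow> 'v \<Rightarrow> 'v \<Rightarrow> 'v \<Rightarrow> real" where
  "step x b y c = (if {x, y} \<subseteq> A \<and> {b, c} \<subseteq> comB x y \<and> P \<le> p x y \<and> q b c \<le> Q
     then 1 / p x y else 0)"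

definition wt :: "'v \<times> 'v \<Rightarrow> 'v \<times> 'v \<Rightarrow> real" where
  "wt u v = step (fst u) (snd u) (fst v) (snd v)"

lemma finite_simps [simp]:
  "finite (nbrs b)" "finite (comB x y)" "finite (comA b c)" "finite rungs"
proof -
  show "finite (nbrs b)" "finite (comB x y)" "finite (comA b c)"
    using finA finB by (auto simp: nbrs_def comB_def comA_def)
  have "rungs \<subseteq> A \<times> B" by (auto simp: rungs_def)
  then show "finite rungs" using finA finB by (meson finite_SigmaI finite_subset)
qed

lemma com_sym: "comB x y = comB y x" "comA b c = comA c b"
  by (auto simp: comB_def comA_def)

lemma p_sym: "p x y = p y x" and q_sym: "q b c = q c b"
  by (simp_all add: p_def q_def com_sym)

lemma p_nonneg: "0 \<le> p x y" and q_nonneg: "0 \<le> q b c"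
  by (simp_all add: p_def q_def)

lemma step_nonneg: "0 \<le> step x b y c"
  by (simp add: step_def p_nonneg)

lemma step_pos_imp:
  assumes "0 < step x b y c"
  shows "adj x b" "adj x c" "adj y b"
  using assms by (auto simp: step_def comB_def split: if_splits)

sublocale weighted_graph rungs wt
proof
  show "wt u v = wt v u" for u v
    by (simp add: wt_def step_def p_sym[of "fst u"] q_sym[of "snd u"] com_sym(1)[of "fst u"] insert_commute)
qed (simp_all add: wt_def step_nonneg)

lemma step_eq_0: "(y, c) \<notin> (SIGMA y:nbrs b. comB x y) \<Longrightarrow> step x b y c = 0"
  by (auto simp: step_def nbrs_def comB_def)

lemma sum_over_rungs:
  "(\<Sum>v\<in>rungs. g v * wt v (x, b)) = (\<Sum>y\<in>nbrs b. \<Sum>c\<in>comB x y. g (y, c) * step x b y c)"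
proof -
  have "(\<Sum>v\<in>rungs. g v * wt v (x, b)) = (\<Sum>v\<in>(SIGMA y:nbrs b. comB x y). g v * wt v (x, b))"
  proof (rule sum.mono_neutral_right)
    show "(SIGMA y:nbrs b. comB x y) \<subseteq> rungs" by (auto simp: nbrs_def comB_def rungs_def)
    show "\<forall>v\<in>rungs - (SIGMA y:nbrs b. comB x y). g v * wt v (x, b) = 0"
      by (auto simp: wt_def intro!: step_eq_0) (auto simp: nbrs_def comB_def rungs_def)
  qed simp
  also have "\<dots> = (\<Sum>v\<in>(SIGMA y:nbrs b. comB x y). g v * step x b (fst v) (snd v))"
    by (subst sym) (simp add: wt_def)
  finally show ?thesis by (simp add: sum.Sigma split_def)
qed

lemma step_le: "step x b y c \<le> 1 / p x y"
  by (simp add: step_def p_nonneg)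

text \<open>The weight \<open>1 / p x y\<close> is chosen for this bound: there are only
  \<open>p x y\<close> candidates for \<open>c\<close>.\<close>

lemma sum_step_le_1: "(\<Sum>c\<in>comB x y. step x b y c) \<le> 1"
proof -
  have "(\<Sum>c\<in>comB x y. step x b y c) \<le> (\<Sum>c\<in>comB x y. 1 / p x y)"
    by (intro sum_mono step_le)
  then show ?thesis by (simp add: p_def split: if_splits)
qed

lemma wt_row_le: "(\<Sum>v\<in>rungs. wt v (x, b)) \<le> card (nbrs b)"
  using sum_over_rungs[of "\<lambda>_. 1" x b] sum_mono[of "nbrs b" "\<lambda>y. \<Sum>c\<in>comB x y. step x b y c" "\<lambda>_. 1"]
  by (simp add: sum_step_le_1)

text \<open>Here \<open>y\<close> is a common neighbour of \<open>b\<close> and \<open>c\<close>.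
  Unless all the weights vanish, there are at most \<open>Q\<close> of these, each of weight at most
  \<open>1 / P\<close>.\<close>

lemma sum_step_fixed_c_le:
  "(\<Sum>y\<in>nbrs b. of_bool (c \<in> comB x y) * step x b y c) \<le> Q / P"
proof (cases "q b c \<le> Q")
  case True
  have "(\<Sum>y\<in>nbrs b. of_bool (c \<in> comB x y) * step x b y c) =
    (\<Sum>y\<in>comA b c. of_bool (c \<in> comB x y) * step x b y c)"
    by (rule sum.mono_neutral_right) (auto simp: comA_def nbrs_def comB_def finA)
  also have "\<dots> \<le> (\<Sum>y\<in>comA b c. 1 / P)"
  proof (rule sum_mono)
    fix y show "of_bool (c \<in> comB x y) * step x b y c \<le> 1 / P"
      using P_pos by (auto simp: step_def intro!: divide_left_mono)
  qed
  also have "\<dots> = q b c / P" by (simp add: q_def)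
  also have "\<dots> \<le> Q / P" using True P_pos by (simp add: divide_right_mono)
  finally show ?thesis .
qed (use P_pos Q_nonneg in \<open>simp add: step_def\<close>)

text \<open>Either \<open>v\<close> is the first end of the neighbouring rung, and the normalisation
  of the weights gives \<open>1\<close>, or it is the second end, and the cap on codegrees gives
  \<open>Q / P\<close>.\<close>

lemma wt_vertex_le:
  assumes "u \<in> rungs"
  shows "(\<Sum>a\<in>rungs. of_bool (v \<in> {fst a, snd a}) * wt a u) \<le> 1 + Q / P"
proof -
  obtain x b where u: "u = (x, b)" by (cases u)
  have "(\<Sum>a\<in>rungs. of_bool (v \<in> {fst a, snd a}) * wt a u) \<le>
    (\<Sum>a\<in>rungs. of_bool (fst a = v) * wt a u) + (\<Sum>a\<in>rungs. of_bool (snd a = v) * wt a u)"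
    unfolding sum.distrib[symmetric] by (intro sum_mono) (auto simp: nonneg)
  moreover have "(\<Sum>a\<in>rungs. of_bool (fst a = v) * wt a u) \<le> 1"
  proof -
    have "(\<Sum>a\<in>rungs. of_bool (fst a = v) * wt a u) =
      (\<Sum>y\<in>nbrs b. if y = v then (\<Sum>c\<in>comB x v. step x b v c) else 0)"
      unfolding u sum_over_rungs by (intro sum.cong) auto
    then show ?thesis using sum_step_le_1[of x b v] by (simp add: sum.delta)
  qed
  moreover have "(\<Sum>a\<in>rungs. of_bool (snd a = v) * wt a u) \<le> Q / P"
  proof -
    have "(\<Sum>a\<in>rungs. of_bool (snd a = v) * wt a u) =
      (\<Sum>y\<in>nbrs b. \<Sum>c\<in>comB x y. if c = v then step x b y v else 0)"
      unfolding u sum_over_rungs by (intro sum.cong) auto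
    also have "\<dots> = (\<Sum>y\<in>nbrs b. of_bool (v \<in> comB x y) * step x b y v)"
      by (intro sum.cong) (auto simp: sum.delta)
    finally show ?thesis using sum_step_fixed_c_le by simp
  qed
  ultimately show ?thesis by linarith
qed

lemma sum_wt_eq:
  "(\<Sum>u\<in>rungs. \<Sum>v\<in>rungs. wt u v) = (\<Sum>x\<in>A. \<Sum>y\<in>A. \<Sum>b\<in>B. \<Sum>c\<in>B. step x b y c)"
proof -
  have sub: "rungs \<subseteq> A \<times> B" by (auto simp: rungs_def)
  have z: "wt u v = 0" if "u \<notin> rungs \<or> v \<notin> rungs" for u v
    using that by (cases u; cases v) (auto simp: wt_def step_def rungs_def comB_def)
  have "(\<Sum>u\<in>rungs. \<Sum>v\<in>rungs. wt u v) = (\<Sum>u\<in>rungs. \<Sum>v\<in>A\<times>B. wt u v)"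
    by (rule sum.cong[OF refl], rule sum.mono_neutral_left) (use sub z finA finB in auto)
  also have "\<dots> = (\<Sum>u\<in>A\<times>B. \<Sum>v\<in>A\<times>B. wt u v)"
    by (rule sum.mono_neutral_left) (use sub z finA finB in auto)
  also have "\<dots> = (\<Sum>x\<in>A. \<Sum>b\<in>B. \<Sum>y\<in>A. \<Sum>c\<in>B. step x b y c)"
    by (simp add: sum.cartesian_product' wt_def)
  also have "\<dots> = (\<Sum>x\<in>A. \<Sum>y\<in>A. \<Sum>b\<in>B. \<Sum>c\<in>B. step x b y c)"
    by (rule sum.cong[OF refl], rule sum.swap)
  finally show ?thesis .
qed

text \<open>The number of labelled 4-cycles \<open>x b y c\<close>, degenerate ones included, whose
  diagonal \<open>b c\<close> has codegree above \<open>Q\<close>: the square counts the choices of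
  \<open>x\<close> and \<open>y\<close>.\<close>

definition heavy :: real where
  "heavy = (\<Sum>b\<in>B. \<Sum>c\<in>B. if Q < q b c then (q b c)\<^sup>2 else 0)"

lemma q_square: "(q b c)\<^sup>2 = (\<Sum>x\<in>A. \<Sum>y\<in>A. of_bool ({b, c} \<subseteq> comB x y))" if "b \<in> B" "c \<in> B"
proof -
  have "(\<Sum>x\<in>A. \<Sum>y\<in>A. of_bool ({b, c} \<subseteq> comB x y)) =
    (\<Sum>x\<in>A. \<Sum>y\<in>A. of_bool (x \<in> comA b c) * of_bool (y \<in> comA b c) :: real)"
    using that by (intro sum.cong) (auto simp: comA_def comB_def)
  also have "\<dots> = (\<Sum>x\<in>A. of_bool (x \<in> comA b c)) * (\<Sum>y\<in>A. of_bool (y \<in> comA b c))"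
    by (simp only: sum_product)
  also have "(\<Sum>x\<in>A. of_bool (x \<in> comA b c)) = (q b c :: real)"
    using finA by (simp add: q_def comA_def sum_of_bool_card del: sum_of_bool_eq)
  finally show ?thesis by (simp add: power2_eq_square)
qed

lemma sum_p: "(\<Sum>x\<in>A. \<Sum>y\<in>A. p x y) = (\<Sum>b\<in>B. (card (nbrs b))\<^sup>2)"
proof -
  have "p x y = (\<Sum>b\<in>B. of_bool (adj x b) * of_bool (adj y b))" for x y
    using sum_of_bool_card[OF finB, of "\<lambda>b. adj x b \<and> adj y b"] by (simp add: p_def comB_def of_bool_conj del: sum_of_bool_eq)
  then have "(\<Sum>x\<in>A. \<Sum>y\<in>A. p x y) = (\<Sum>x\<in>A. \<Sum>y\<in>A. \<Sum>b\<in>B. of_bool (adj x b) * of_bool (adj y b))"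
    by simp
  also have "\<dots> = (\<Sum>b\<in>B. \<Sum>x\<in>A. \<Sum>y\<in>A. of_bool (adj x b) * of_bool (adj y b))"
    by (rule trans[OF sum.cong[OF refl sum.swap] sum.swap])
  also have "\<dots> = (\<Sum>b\<in>B. (\<Sum>x\<in>A. of_bool (adj x b)) * (\<Sum>y\<in>A. of_bool (adj y b)))"
    by (simp only: sum_product)
  also have "\<dots> = (\<Sum>b\<in>B. (card (nbrs b))\<^sup>2)"
    using finA by (simp add: nbrs_def sum_of_bool_card power2_eq_square del: sum_of_bool_eq)
  finally show ?thesis by simp
qed

lemma card_rungs: "card rungs = (\<Sum>b\<in>B. card (nbrs b))"
proof -
  have "bij_betw prod.swap (SIGMA b:B. nbrs b) rungs"
    by (rule bij_betwI[where g = prod.swap]) (auto simp: rungs_def nbrs_def)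
  then have "card rungs = card (SIGMA b:B. nbrs b)" by (simp add: bij_betw_same_card)
  then show ?thesis using finB by simp
qed

text \<open>A pair of codegree at least \<open>P\<close> carries the weight \<open>p x y\<close>,
  except that each heavy diagonal costs at most \<open>1 / P\<close>; any other pair loses less than
  \<open>P\<close>. The codegrees sum to at least \<open>(card rungs)\<^sup>2 / card B\<close> by
  Cauchy-Schwarz.\<close>

lemma sum_wt_lower:
  assumes "B \<noteq> {}"
  shows "(card rungs)\<^sup>2 / card B - (card A)\<^sup>2 * P - heavy / P \<le> (\<Sum>u\<in>rungs. \<Sum>v\<in>rungs. wt u v)"
proof -
  define hv where "hv x y = (\<Sum>b\<in>B. \<Sum>c\<in>B. of_bool ({b, c} \<subseteq> comB x y \<and> Q < q b c) :: real)" for x y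
  have hv0: "0 \<le> hv x y" for x y by (simp add: hv_def sum_nonneg)
  have psq: "(p x y)\<^sup>2 = (\<Sum>b\<in>B. \<Sum>c\<in>B. of_bool ({b, c} \<subseteq> comB x y))" for x y
  proof -
    have "(\<Sum>b\<in>B. \<Sum>c\<in>B. of_bool ({b, c} \<subseteq> comB x y)) =
      (\<Sum>b\<in>B. of_bool (b \<in> comB x y)) * (\<Sum>c\<in>B. of_bool (c \<in> comB x y) :: real)"
      by (simp add: sum_product of_bool_conj)
    also have "(\<Sum>b\<in>B. of_bool (b \<in> comB x y)) = (p x y :: real)"
      using finB by (simp add: p_def comB_def sum_of_bool_card del: sum_of_bool_eq)
    finally show ?thesis by (simp add: power2_eq_square)
  qed
  have cell: "p x y - P - hv x y / P \<le> (\<Sum>b\<in>B. \<Sum>c\<in>B. step x b y c)" if "x \<in> A" "y \<in> A" for x y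
  proof (cases "P \<le> p x y")
    case True
    then have pp: "0 < p x y" using P_pos by linarith
    have "(\<Sum>b\<in>B. \<Sum>c\<in>B. step x b y c) =
      (\<Sum>b\<in>B. \<Sum>c\<in>B. (of_bool ({b, c} \<subseteq> comB x y) - of_bool ({b, c} \<subseteq> comB x y \<and> Q < q b c)) / p x y)"
      using True that by (intro sum.cong) (auto simp: step_def)
    also have "\<dots> = ((p x y)\<^sup>2 - hv x y) / p x y"
      by (simp add: psq hv_def sum_subtractf flip: sum_divide_distrib)
    also have "\<dots> = p x y - hv x y / p x y" using pp by (simp add: diff_divide_distrib power2_eq_square)
    also have "\<dots> \<ge> p x y - hv x y / P"
      using True P_pos hv0[of x y] by (simp add: divide_left_mono)
    finally show ?thesis using P_pos by linarith
  next
    case False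
    have "0 \<le> (\<Sum>b\<in>B. \<Sum>c\<in>B. step x b y c)" by (intro sum_nonneg step_nonneg)
    moreover have "0 \<le> hv x y / P" using hv0[of x y] P_pos by simp
    ultimately show ?thesis using False by linarith
  qed
  have "(\<Sum>x\<in>A. \<Sum>y\<in>A. p x y - P - hv x y / P) \<le> (\<Sum>x\<in>A. \<Sum>y\<in>A. \<Sum>b\<in>B. \<Sum>c\<in>B. step x b y c)"
    by (intro sum_mono cell)
  moreover have "(\<Sum>x\<in>A. \<Sum>y\<in>A. hv x y) = heavy"
  proof -
    have "(\<Sum>x\<in>A. \<Sum>y\<in>A. hv x y) =
      (\<Sum>x\<in>A. \<Sum>b\<in>B. \<Sum>c\<in>B. \<Sum>y\<in>A. of_bool ({b, c} \<subseteq> comB x y \<and> Q < q b c))"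
      unfolding hv_def
      by (rule sum.cong[OF refl], rule trans[OF sum.swap], rule sum.cong[OF refl], rule sum.swap)
    also have "\<dots> = (\<Sum>b\<in>B. \<Sum>c\<in>B. \<Sum>x\<in>A. \<Sum>y\<in>A. of_bool ({b, c} \<subseteq> comB x y \<and> Q < q b c))"
      by (rule trans[OF sum.swap], rule sum.cong[OF refl], rule sum.swap)
    also have "\<dots> = heavy"
      unfolding heavy_def by (intro sum.cong refl) (simp add: q_square)
    finally show ?thesis .
  qed
  moreover have "(card rungs)\<^sup>2 / card B \<le> (\<Sum>x\<in>A. \<Sum>y\<in>A. p x y)"
  proof -
    have "(\<Sum>b\<in>B. real (card (nbrs b)))\<^sup>2 \<le> card B * (\<Sum>b\<in>B. (real (card (nbrs b)))\<^sup>2)"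
      using Cauchy_Schwarz_ineq_sum[of "\<lambda>b. real (card (nbrs b))" "\<lambda>_. 1" B] by (simp add: mult.commute)
    moreover have "0 < card B" using assms finB by (simp add: card_gt_0_iff)
    ultimately show ?thesis by (simp add: sum_p card_rungs pos_divide_le_eq mult.commute)
  qed
  ultimately show ?thesis
    by (simp add: sum_wt_eq sum_subtractf power2_eq_square flip: sum_divide_distrib)
qed

text \<open>If the ratio condition of \<open>two_disjoint_cycles\<close> failed,
  \<open>closed_wt_le_power\<close> would bound \<open>closed_wt k\<close> by a quantity that
  \<open>big\<close> puts below the lower bound \<open>D ^ (2 * k)\<close>.\<close>

lemma two_disjoint_ladders:
  fixes D Dl :: real
  assumes k: "0 < k" and B: "rungs \<noteq> {}"
    and deg: "\<And>b. b \<in> B \<Longrightarrow> card (nbrs b) \<le> Dl"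
    and W: "D * card rungs \<le> (card rungs)\<^sup>2 / card B - (card A)\<^sup>2 * P - heavy / P" and D: "0 \<le> D"
    and big: "(64 * k ^ 5 * (1 + Q / P) * Dl) ^ k * card rungs < D ^ (2 * k)"
  shows "\<exists>xs ys. disjoint_cycle (\<lambda>u. {fst u, snd u}) (2 * k) xs \<and>
    disjoint_cycle (\<lambda>u. {fst u, snd u}) (2 * k) ys \<and> xs ! 0 = ys ! 0 \<and>
    (\<forall>i<2*k. \<forall>j<2*k. 0 < i \<longrightarrow> 0 < j \<longrightarrow> {fst (xs ! i), snd (xs ! i)} \<inter> {fst (ys ! j), snd (ys ! j)} = {})"
proof (rule two_disjoint_cycles[OF k])
  show "card {fst z, snd z} \<le> 2" for z :: "'v \<times> 'v" by (simp add: card_insert_if)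
  show row: "(\<Sum>a\<in>rungs. wt a u) \<le> Dl" if "u \<in> rungs" for u
    using wt_row_le[of "fst u" "snd u"] deg[of "snd u"] that by (auto simp: rungs_def)
  obtain u where u: "u \<in> rungs" using B by blast
  have "0 \<le> Dl" using row[OF u] sum_nonneg[of rungs "\<lambda>a. wt a u"] nonneg by simp
  then have r0: "0 \<le> 64 * real k ^ 5 * (1 + Q / P) * Dl" (is "0 \<le> ?r")
    using P_pos Q_nonneg by simp
  have "B \<noteq> {}" using u by (auto simp: rungs_def)
  then have "D * card rungs \<le> (\<Sum>u\<in>rungs. \<Sum>v\<in>rungs. wt u v)" using W sum_wt_lower by linarith
  then have ge: "D ^ (2 * k) \<le> closed_wt k" using closed_wt_ge_power D B by blast
  show "?r * closed_wt (k - 1) < closed_wt k"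
  proof (rule ccontr)
    assume "\<not> ?thesis"
    then have "closed_wt k \<le> ?r ^ k * card rungs"
      using closed_wt_le_power[of "k - 1" ?r] r0 k by simp
    then show False using ge big by linarith
  qed
qed (use wt_vertex_le in simp_all)

end

section \<open>Few 4-cycles have a diagonal of large codegree\<close>

definition edge_count :: "('v \<Rightarrow> 'v \<Rightarrow> bool) \<Rightarrow> 'v set \<Rightarrow> 'v set \<Rightarrow> nat" where
  "edge_count adj S T = (\<Sum>y\<in>T. card {x \<in> S. adj x y})"

text \<open>
  The last two summands matter only for very unbalanced pairs. The exponent must be below \<open>1/2\<close> to make
  the sum over the codegrees in \<open>heavy_row_bound\<close> converge.
\<close>

definition phi :: "real \<Rightarrow> real \<Rightarrow> real" where
  "phi s t = (s * t) powr (3/4) + s * t powr (15/32) + t * s powr (15/32)"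

lemma phi_mono: "0 \<le> s \<Longrightarrow> s \<le> s' \<Longrightarrow> 0 \<le> t \<Longrightarrow> t \<le> t' \<Longrightarrow> phi s t \<le> phi s' t'"
  unfolding phi_def by (intro add_mono mult_mono powr_mono2) simp_all

text \<open>Each term is at most the corresponding increment of \<open>2 * sqrt m\<close>.\<close>

lemma sum_sqrt_inverse_le: "(\<Sum>i=1..m. real i powr (-1/2)) \<le> 2 * sqrt m"
proof (induction m)
  case (Suc m)
  have "real (Suc m) powr (-1/2) \<le> 2 * sqrt (Suc m) - 2 * sqrt m"
  proof -
    have "sqrt m \<le> sqrt (Suc m)" by simp
    then have "1 \<le> (sqrt (Suc m) - sqrt m) * (2 * sqrt (Suc m))"
      using mult_left_mono[of "sqrt (Suc m) + sqrt m" "2 * sqrt (Suc m)" "sqrt (Suc m) - sqrt m"]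
      by (simp add: algebra_simps flip: power2_eq_square)
    then have "1 / sqrt (Suc m) \<le> 2 * sqrt (Suc m) - 2 * sqrt m"
      by (subst pos_divide_le_eq) (simp_all add: algebra_simps)
    then show ?thesis by (simp add: powr_minus_divide powr_half_sqrt)
  qed
  with Suc show ?case by simp
qed simp

text \<open>Elements of small value are removed one by one: the one removed when \<open>i\<close>
  elements remain contributes at most \<open>(h i)\<^sup>2\<close>.\<close>

lemma sum_squares_le_ranked:
  fixes g :: "'a \<Rightarrow> real"
  assumes "finite W" "\<And>x. x \<in> W \<Longrightarrow> 0 \<le> g x"
    and "\<And>X. X \<subseteq> W \<Longrightarrow> X \<noteq> {} \<Longrightarrow> \<exists>x\<in>X. g x \<le> h (card X)"
  shows "(\<Sum>x\<in>W. (g x)\<^sup>2) \<le> (\<Sum>i=1..card W. (h i)\<^sup>2)"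
  using assms
proof (induction "card W" arbitrary: W)
  case (Suc n)
  then have "W \<noteq> {}" by auto
  then obtain x where x: "x \<in> W" "g x \<le> h (card W)" using Suc.prems(3)[of W] by blast
  have n: "card (W - {x}) = n" using Suc.hyps(2) Suc.prems(1) x(1) by simp
  have "(\<Sum>x\<in>W - {x}. (g x)\<^sup>2) \<le> (\<Sum>i=1..card (W - {x}). (h i)\<^sup>2)"
    using Suc.prems by (intro Suc.hyps(1)[OF n[symmetric]]) (auto dest: subset_trans)
  moreover have "(g x)\<^sup>2 \<le> (h (Suc n))\<^sup>2"
    using x Suc.prems(2)[of x] Suc.hyps(2) by (intro power_mono) simp_all
  ultimately show ?case
    using Suc.prems(1) x(1) by (simp add: sum.remove n flip: Suc.hyps(2))
qed simp

text \<open>If \<open>i\<close> exceeded \<open>ka * D\<close>, each of the three summands of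
  \<open>phi D i\<close> would be at most \<open>i * D powr (1/2) / ka\<close>, and the factor
  \<open>4\<close> is larger than their number.\<close>

lemma few_heavy:
  fixes i f D ka :: real
  assumes i: "0 < i" and f: "0 < f" and D: "1 \<le> D" and ka: "0 < ka" "ka \<le> 1"
    and le: "4 / ka * f * D powr (1/2) * i \<le> f * phi D i"
  shows "i \<le> ka * D"
proof (rule ccontr)
  assume "\<not> ?thesis"
  then have r: "D / i \<le> 1 / ka" using i ka by (simp add: field_simps)
  have ka1: "1 \<le> 1 / ka" using ka by simp
  have pw: "(D / i) powr c \<le> 1 / ka" if "0 \<le> c" "c \<le> 1" for c
  proof -
    have "(D / i) powr c \<le> (1 / ka) powr c" using r i D that by (intro powr_mono2) simp_all
    also have "\<dots> \<le> (1 / ka) powr 1" using ka1 that by (intro powr_mono) simp_all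
    finally show ?thesis using ka by simp
  qed
  have "(D * i) powr (3/4) = i * D powr (1/2) * (D / i) powr (1/4)"
    using i D by (simp add: powr_mult powr_divide field_simps flip: powr_add powr_realpow)
  also have "\<dots> \<le> i * D powr (1/2) * (1 / ka)"
    using i pw[of "1/4"] by (intro mult_left_mono) simp_all
  finally have 1: "(D * i) powr (3/4) \<le> i * D powr (1/2) * (1 / ka)" .
  have "D powr (15/32) \<le> D powr (1/2)" using D by (intro powr_mono) simp_all
  then have "i * D powr (15/32) \<le> i * D powr (1/2)" using i by simp
  also have "\<dots> \<le> i * D powr (1/2) * (1 / ka)"
    using mult_left_mono[OF ka1, of "i * D powr (1/2)"] i by simp
  finally have 2: "i * D powr (15/32) \<le> i * D powr (1/2) * (1 / ka)" .
  have "D * i powr (15/32) = i * D powr (15/32) * (D / i) powr (17/32)"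
    using i D by (simp add: powr_divide field_simps flip: powr_add)
  also have "\<dots> \<le> i * D powr (1/2) * (1 / ka)"
    using i pw[of "17/32"] \<open>D powr (15/32) \<le> D powr (1/2)\<close> by (intro mult_mono) simp_all
  finally have 3: "D * i powr (15/32) \<le> i * D powr (1/2) * (1 / ka)" .
  have "phi D i \<le> 3 * (i * D powr (1/2) * (1 / ka))"
    unfolding phi_def using add_mono[OF add_mono[OF 1 3] 2] by simp
  also have "\<dots> < 4 / ka * D powr (1/2) * i" using i ka D by (simp add: field_simps)
  finally have "f * phi D i < f * (4 / ka * D powr (1/2) * i)"
    using f by (rule mult_strict_left_mono)
  then show False using le by (simp add: mult_ac)
qed

context bipartite_pair
begin

lemma sum_q: "(\<Sum>c\<in>X. q b c) = edge_count adj (nbrs b) X"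
  by (simp add: q_def edge_count_def nbrs_def comA_def conj_assoc)

text \<open>\<open>H\<close> bounds the average codegree over any \<open>i\<close> vertices by
  \<open>f * phi D i / i\<close>, so codegrees decay with their rank like \<open>u i + v i\<close>.
  The squares of \<open>u\<close> stay small because \<open>few\<close> limits the ranks to
  \<open>ka * D\<close>; those of \<open>v\<close> gain \<open>f powr (-1/17)\<close> by
  interpolation with the trivial bound \<open>D\<close>.\<close>

lemma heavy_row_bound:
  fixes f D ka :: real
  defines "ze \<equiv> (\<Sum>i. real i powr (-33/32))"
  assumes b: "b \<in> B" and f: "1 \<le> f" and D: "1 \<le> D" and ka: "0 < ka" "ka \<le> 1"
    and deg: "card (nbrs b) \<le> D"
    and H: "\<And>X. X \<subseteq> B \<Longrightarrow> edge_count adj (nbrs b) X \<le> f * phi (card (nbrs b)) (card X)"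
    and Q: "Q = 4 / ka * f * D powr (1/2)"
  shows "(\<Sum>c\<in>B. if Q < q b c then (q b c)\<^sup>2 else 0) \<le>
    D\<^sup>2 * f\<^sup>2 * (16 * sqrt ka + 2 * ze * f powr (-1/17))"
proof -
  define W where "W = {c \<in> B. Q < q b c}"
  \<comment> \<open>The factor \<open>2\<close> also absorbs the summand of \<open>phi\<close> with
    \<open>D powr (15/32)\<close>, since \<open>i\<close> is at most \<open>D\<close>. The summand
    with \<open>i powr (15/32)\<close> leads to \<open>v\<close>, cut off at
    \<open>D\<close>.\<close>
  define u where "u i = 2 * f * D powr (3/4) * real i powr (-1/4)" for i :: nat
  define v where "v i = min D (f * D * real i powr (-17/32))" for i :: nat
  have finW: "finite W" using finB by (simp add: W_def)
  have XW: "finite X" "X \<subseteq> B" if "X \<subseteq> W" for X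
    using that finW by (auto simp: W_def intro: finite_subset)
  have tot: "(\<Sum>c\<in>X. q b c) \<le> f * phi D (card X)" if "X \<subseteq> W" for X
  proof -
    have "(\<Sum>c\<in>X. q b c) \<le> f * phi (card (nbrs b)) (card X)"
      using H[OF XW(2)[OF that]] by (simp add: sum_q)
    also have "\<dots> \<le> f * phi D (card X)" using f deg by (intro mult_left_mono phi_mono) simp_all
    finally show ?thesis .
  qed
  have few: "card X \<le> ka * D" if "X \<subseteq> W" "X \<noteq> {}" for X
  proof -
    have pos: "0 < real (card X)" using that XW[OF that(1)] by (simp add: card_gt_0_iff)
    have "(\<Sum>c\<in>X. Q) \<le> (\<Sum>c\<in>X. q b c)" using that by (intro sum_mono) (auto simp: W_def)
    with tot[OF that(1)] have "Q * card X \<le> f * phi D (card X)" by (simp add: mult.commute)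
    then show ?thesis using few_heavy[OF pos _ D ka, of f] f by (simp add: Q)
  qed
  have qD: "q b c \<le> D" for c
  proof -
    have "card (comA b c) \<le> card (nbrs b)" by (intro card_mono) (auto simp: comA_def nbrs_def finA)
    then show ?thesis using deg by (simp add: q_def)
  qed
  have "\<exists>c\<in>X. q b c \<le> u (card X) + v (card X)" if X: "X \<subseteq> W" "X \<noteq> {}" for X
  proof -
    define i where "i = real (card X)"
    have i: "0 < i" using X XW[OF X(1)] by (simp add: card_gt_0_iff i_def)
    have "ka * D \<le> 1 * D" using ka D by (intro mult_right_mono) simp_all
    then have iD: "i \<le> D" using few[OF X] by (simp add: i_def)
    obtain c where c: "c \<in> X" "q b c * i \<le> (\<Sum>c\<in>X. q b c)"
    proof -
      have "\<not> (\<forall>c\<in>X. (\<Sum>c\<in>X. q b c) / i < q b c)"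
      proof
        assume "\<forall>c\<in>X. (\<Sum>c\<in>X. q b c) / i < q b c"
        then have "(\<Sum>c\<in>X. (\<Sum>c\<in>X. q b c) / i) < (\<Sum>c\<in>X. q b c)"
          using X XW[OF X(1)] by (intro sum_strict_mono) auto
        then show False using i by (simp add: i_def)
      qed
      then show ?thesis using that i by (auto simp: not_less le_divide_eq)
    qed
    then have "q b c * i \<le> f * phi D i" using tot[OF X(1)] by (simp add: i_def)
    then have "q b c \<le> f * phi D i / i" using i by (simp add: le_divide_eq)
    also have "\<dots> \<le> u (card X) + f * D * i powr (-17/32)"
    proof -
      have "phi D i / i = D powr (3/4) * i powr (-1/4) + D * i powr (-17/32) + D powr (15/32)"
      proof -
        have "i powr (3/4) / i = i powr (-1/4)" "i powr (15/32) / i = i powr (-17/32)"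
          using i powr_diff[of i "3/4" 1] powr_diff[of i "15/32" 1] by simp_all
        then show ?thesis
          using i D by (simp add: phi_def add_divide_distrib powr_mult flip: times_divide_eq_right) simp
      qed
      moreover have "D powr (15/32) \<le> D powr (3/4) * i powr (-1/4)"
      proof -
        have "D powr (15/32) \<le> D powr (1/2)" using D by (intro powr_mono) simp_all
        also have "\<dots> = D powr (3/4) * D powr (-1/4)" using D by (simp flip: powr_add)
        also have "\<dots> \<le> D powr (3/4) * i powr (-1/4)"
          using i iD by (intro mult_left_mono powr_mono2') simp_all
        finally show ?thesis .
      qed
      ultimately have "phi D i / i \<le> 2 * (D powr (3/4) * i powr (-1/4)) + D * i powr (-17/32)" by linarith
      then have "f * (phi D i / i) \<le> f * (2 * (D powr (3/4) * i powr (-1/4)) + D * i powr (-17/32))"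
        using f by (intro mult_left_mono) simp_all
      then show ?thesis by (simp add: u_def i_def algebra_simps)
    qed
    finally have "q b c \<le> u (card X) + f * D * i powr (-17/32)" .
    moreover have "0 \<le> u (card X)" using f by (simp add: u_def)
    ultimately have "q b c \<le> u (card X) + v (card X)"
      using qD[of c] by (simp add: v_def i_def min_def)
    then show ?thesis using c by blast
  qed
  then have "(\<Sum>c\<in>W. (q b c)\<^sup>2) \<le> (\<Sum>i=1..card W. (u i + v i)\<^sup>2)"
    using finW by (intro sum_squares_le_ranked) (simp_all add: q_nonneg)
  also have "\<dots> \<le> (\<Sum>i=1..card W. 8 * f\<^sup>2 * D powr (3/2) * real i powr (-1/2) +
      2 * D\<^sup>2 * f powr (33/17) * real i powr (-33/32))"
  proof (rule sum_mono)
    fix i assume "i \<in> {1..card W}"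
    then have i: "0 < real i" by simp
    have "(u i + v i)\<^sup>2 \<le> 2 * (u i)\<^sup>2 + 2 * (v i)\<^sup>2"
      using sum_squares_bound[of "u i" "v i"] by (simp add: power2_sum)
    moreover have "(u i)\<^sup>2 = 4 * f\<^sup>2 * D powr (3/2) * real i powr (-1/2)"
      using i D by (simp add: u_def power_mult_distrib powr_power)
    moreover have "(v i)\<^sup>2 \<le> D\<^sup>2 * f powr (33/17) * real i powr (-33/32)"
    proof -
      define x where "x = f * real i powr (-17/32)"
      have x: "0 < x" using f i by (simp add: x_def)
      have "v i = D * min 1 x" using D by (simp add: v_def x_def min_def mult_ac)
      \<comment> \<open>The exponent \<open>33/17\<close> is below \<open>2\<close>, which saves a
        power of \<open>f\<close>, while \<open>17/32 * 33/17 = 33/32\<close> exceeds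
        \<open>1\<close>, so that the sum over \<open>i\<close> converges.\<close>
      moreover have "(min 1 x)\<^sup>2 \<le> x powr (33/17)"
      proof (cases "x \<le> 1")
        case True
        then have "x powr 2 \<le> x powr (33/17)" using x by (intro powr_mono') simp_all
        then show ?thesis using True x by simp
      next
        case False
        then show ?thesis using ge_one_powr_ge_zero[of x "33/17"] by simp
      qed
      moreover have "x powr (33/17) = f powr (33/17) * real i powr (-33/32)"
        using f i by (simp add: x_def powr_mult powr_powr)
      ultimately show ?thesis by (simp add: power_mult_distrib mult.assoc mult_left_mono)
    qed
    ultimately show "(u i + v i)\<^sup>2 \<le> 8 * f\<^sup>2 * D powr (3/2) * real i powr (-1/2) +
      2 * D\<^sup>2 * f powr (33/17) * real i powr (-33/32)" by linarith
  qed
  also have "\<dots> = 8 * f\<^sup>2 * D powr (3/2) * (\<Sum>i=1..card W. real i powr (-1/2)) +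
      2 * D\<^sup>2 * f powr (33/17) * (\<Sum>i=1..card W. real i powr (-33/32))"
    by (simp add: sum.distrib sum_distrib_left)
  also have "\<dots> \<le> 8 * f\<^sup>2 * D powr (3/2) * (2 * sqrt (ka * D)) + 2 * D\<^sup>2 * f powr (33/17) * ze"
  proof (intro add_mono mult_left_mono)
    have "real (card W) \<le> ka * D" using few[of W] ka D by (cases "W = {}") simp_all
    then show "(\<Sum>i=1..card W. real i powr (-1/2)) \<le> 2 * sqrt (ka * D)"
      using sum_sqrt_inverse_le[of "card W"] by (smt (verit) real_sqrt_le_mono)
    show "(\<Sum>i=1..card W. real i powr (-33/32)) \<le> ze"
      unfolding ze_def by (rule sum_le_suminf) (simp_all add: summable_real_powr_iff)
  qed simp_all
  also have "\<dots> = D\<^sup>2 * f\<^sup>2 * (16 * sqrt ka + 2 * ze * f powr (-1/17))"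
  proof -
    have "D powr (3/2) * sqrt D = D powr (3/2 + 1/2)" using D by (simp only: powr_add powr_half_sqrt)
    then have 1: "D powr (3/2) * sqrt D = D\<^sup>2" using D by simp
    have "f powr (33/17) = f powr (2 + -1/17)" by simp
    also have "\<dots> = f powr 2 * f powr (-1/17)" by (rule powr_add)
    finally have 2: "f powr (33/17) = f\<^sup>2 * f powr (-1/17)" using f by simp
    have "8 * f\<^sup>2 * D powr (3/2) * (2 * sqrt (ka * D)) = 16 * f\<^sup>2 * (D powr (3/2) * sqrt D) * sqrt ka"
      by (simp add: real_sqrt_mult)
    then show ?thesis unfolding 1 2 by (simp add: algebra_simps)
  qed
  finally show ?thesis
    using finB by (simp add: W_def sum.If_cases Int_def)
qed

end

section \<open>Ladders in dense pairs\<close>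

text \<open>Rails join the first end of a rung to the second end of the next one, as edges of a
  bipartite pair must; \<open>ladder_vertex\<close> undoes this twist.\<close>

definition ladder :: "('v \<Rightarrow> 'v \<Rightarrow> bool) \<Rightarrow> nat \<Rightarrow> ('v \<times> 'v) list \<Rightarrow> bool" where
  "ladder adj n xs \<longleftrightarrow> length xs = n \<and>
     (\<forall>i<n. adj (fst (xs ! i)) (snd (xs ! i)) \<and>
        adj (fst (xs ! i)) (snd (xs ! (Suc i mod n))) \<and>
        adj (fst (xs ! (Suc i mod n))) (snd (xs ! i))) \<and>
     (\<forall>i<n. \<forall>j<n. i \<noteq> j \<longrightarrow> {fst (xs ! i), snd (xs ! i)} \<inter> {fst (xs ! j), snd (xs ! j)} = {})"

text \<open>Disjointness is demanded only after position \<open>0\<close>, since each ladder already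
  separates the common rung from its other rungs.\<close>

definition ladder_pair :: "('v \<Rightarrow> 'v \<Rightarrow> bool) \<Rightarrow> nat \<Rightarrow> bool" where
  "ladder_pair adj n \<longleftrightarrow> (\<exists>xs ys. ladder adj n xs \<and> ladder adj n ys \<and> xs ! 0 = ys ! 0 \<and>
     (\<forall>i<n. \<forall>j<n. 0 < i \<longrightarrow> 0 < j \<longrightarrow>
        {fst (xs ! i), snd (xs ! i)} \<inter> {fst (ys ! j), snd (ys ! j)} = {}))"

lemma (in bipartite_pair) ladder_if_disjoint_cycle:
  assumes "disjoint_cycle (\<lambda>u. {fst u, snd u}) n xs"
  shows "ladder adj n xs"
proof -
  have "adj (fst (xs ! i)) (snd (xs ! i))"
    "adj (fst (xs ! i)) (snd (xs ! (Suc i mod n)))"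
    "adj (fst (xs ! (Suc i mod n))) (snd (xs ! i))" if "i < n" for i
    using assms that step_pos_imp[of "fst (xs ! i)" "snd (xs ! i)"
      "fst (xs ! (Suc i mod n))" "snd (xs ! (Suc i mod n))"]
    by (auto simp: disjoint_cycle_def wt_def)
  then show ?thesis using assms by (simp add: ladder_def disjoint_cycle_def)
qed

text \<open>The assumption amounts to \<open>x <= y powr (9/8)\<close>, the balance imposed on dense
  pairs. It lets the first summand of \<open>phi\<close> dominate, because
  \<open>15/32 + 9/32 = 3/4\<close>.\<close>

lemma mult_powr_le_powr_mult:
  fixes x y :: real
  assumes "0 < x" "0 < y" "x powr (1/4) \<le> y powr (9/32)"
  shows "x * y powr (15/32) \<le> (x * y) powr (3/4)"
proof -
  have "(x powr (3/4) * y powr (15/32)) * x powr (1/4) \<le> (x powr (3/4) * y powr (15/32)) * y powr (9/32)"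
    using assms by (intro mult_left_mono) simp_all
  moreover have "(x powr (3/4) * y powr (15/32)) * x powr (1/4) = (x powr (3/4) * x powr (1/4)) * y powr (15/32)"
    "(x powr (3/4) * y powr (15/32)) * y powr (9/32) = x powr (3/4) * (y powr (15/32) * y powr (9/32))"
    by (simp_all only: mult_ac)
  moreover have "x powr (3/4) * x powr (1/4) = x" "y powr (15/32) * y powr (9/32) = y powr (3/4)"
    using assms by (simp_all flip: powr_add)
  ultimately have "x * y powr (15/32) \<le> x powr (3/4) * y powr (3/4)" by (simp only:)
  then show ?thesis using assms by (simp only: powr_mult)
qed

text \<open>With \<open>t = (s / b) powr (1/4)\<close> the bound by \<open>phi\<close> gives
  \<open>eh <= 6 * e * t\<close>, while \<open>many\<close> gives
  \<open>663552 * e * t ^ 4 <= eh\<close>. As \<open>663552 = 6 * 48 ^ 3\<close>, this means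
  \<open>t <= 1 / 48\<close>, hence \<open>eh <= e / 8\<close>.\<close>

lemma high_degree_edges:
  fixes a b e eh s f lam :: real
  assumes ab: "1 \<le> a" "a \<le> b" "b \<le> a powr (9/8)"
    and f: "0 < f" and e: "f / 2 * (a * b) powr (3/4) \<le> e"
    and s: "0 \<le> s" "s \<le> b" and eh: "eh \<le> f * phi a s" and many: "663552 * (e / b) * s \<le> eh"
  shows "eh \<le> e / 8"
proof (rule ccontr)
  assume no: "\<not> ?thesis"
  define si where "si = s / b"
  define t where "t = si powr (1/4)"
  have b1: "1 \<le> b" using ab by simp
  have si: "0 \<le> si" "si \<le> 1" "s = si * b" using s b1 by (simp_all add: si_def)
  have t0: "0 \<le> t" by (simp add: t_def)
  have "t powr 4 = si" using si by (simp only: t_def powr_powr) simp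
  with t0 have t: "0 \<le> t" "t ^ 4 = si" by simp_all
  have pw: "si powr c \<le> t" if "1/4 \<le> c" for c
    unfolding t_def using si that by (intro powr_mono') simp_all
  have m0: "0 < (a * b) powr (3/4)" using ab by simp
  have e0: "0 < e" using e f m0 by (smt (verit) divide_pos_pos mult_pos_pos)
  have q1: "a * b powr (15/32) \<le> (a * b) powr (3/4)"
    using powr_mono2[of "1/4" a b] powr_mono[of "1/4" "9/32" b] ab b1
    by (intro mult_powr_le_powr_mult) simp_all
  have q2: "b * a powr (15/32) \<le> (a * b) powr (3/4)"
    using powr_mono2[of "1/4" b "a powr (9/8)"] ab b1 mult_powr_le_powr_mult[of b a]
    by (simp add: powr_powr mult.commute)
  have "(a * s) powr (3/4) = (a * b) powr (3/4) * si powr (3/4)"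
    using ab b1 si by (simp add: powr_mult mult_ac)
  also have "\<dots> \<le> (a * b) powr (3/4) * t" using pw by (intro mult_left_mono) simp_all
  finally have 1: "(a * s) powr (3/4) \<le> (a * b) powr (3/4) * t" .
  have "a * s powr (15/32) = a * b powr (15/32) * si powr (15/32)"
    using ab b1 si by (simp add: powr_mult mult_ac)
  also have "\<dots> \<le> (a * b) powr (3/4) * t" using pw[of "15/32"] q1 by (intro mult_mono) simp_all
  finally have 2: "a * s powr (15/32) \<le> (a * b) powr (3/4) * t" .
  have "s * a powr (15/32) = b * a powr (15/32) * si powr 1"
    using si by simp
  also have "\<dots> \<le> (a * b) powr (3/4) * t" using pw[of 1] q2 si by (intro mult_mono) simp_all
  finally have 3: "s * a powr (15/32) \<le> (a * b) powr (3/4) * t" .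
  have "phi a s \<le> 3 * ((a * b) powr (3/4) * t)"
    unfolding phi_def using add_mono[OF add_mono[OF 1 2] 3] by (simp add: mult.commute)
  then have "f * phi a s \<le> f * (3 * ((a * b) powr (3/4) * t))"
    using f by (intro mult_left_mono) simp_all
  with eh have "eh \<le> f * (3 * ((a * b) powr (3/4) * t))" by (rule order_trans)
  also have "\<dots> = 6 * (f / 2 * (a * b) powr (3/4)) * t" by simp
  also have "\<dots> \<le> 6 * e * t" using e t by (intro mult_right_mono) simp_all
  finally have le: "eh \<le> e * (6 * t)" by simp
  with no have "e * (1 / 8) < e * (6 * t)" by simp
  then have t48: "1 / 48 < t" using e0 by simp
  have "e * (663552 * t ^ 4) \<le> e * (6 * t)"
    using le many b1 by (simp add: si t(2))
  then have "663552 * t ^ 4 \<le> 6 * t" using e0 by simp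
  moreover have "t ^ 4 = t ^ 3 * t" using power_add[of t 3 1] by simp
  ultimately have "(663552 * t ^ 3) * t \<le> 6 * t" by (simp only: mult.assoc)
  then have "663552 * t ^ 3 \<le> 6" by (rule mult_right_le_imp_le) (use t48 in linarith)
  moreover have "(1 / 48) ^ 3 < t ^ 3" using t48 by (rule power_strict_mono) simp_all
  moreover have "(1 / 48 :: real) ^ 3 = 1 / 110592" by (simp add: power3_eq_cube)
  ultimately show False by linarith
qed

text \<open>The exponents satisfy \<open>3/2 + 17/35 + 1/70 = 2\<close>. For \<open>k\<close> at
  least \<open>7\<close> the exponent \<open>17/5\<close> of \<open>N\<close> is at most
  \<open>k * (17/35)\<close>, and the remaining \<open>1/70\<close> absorbs the constants because
  \<open>Dl\<close> is huge.\<close>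

lemma final_inequality:
  fixes Dl K lam L :: real
  assumes k: "7 \<le> k" and K: "0 \<le> K" "(16 * lam\<^sup>2 * K) powr 70 < Dl" "1 \<le> Dl" and lam: "1 \<le> lam"
    and N: "0 \<le> N" "N \<le> Dl powr (17/5)"
    and r: "0 \<le> r" "r \<le> K * Dl powr (3/2)"
  shows "r ^ k * N < (Dl / (4 * lam)) ^ (2 * k)"
proof -
  define M where "M = 16 * lam\<^sup>2 * K"
  have M: "0 \<le> M" using K lam by (simp add: M_def)
  have kk: "17/5 \<le> real k * (17/35)" using k by simp
  have "M < Dl powr (1/70)"
  proof -
    have "(M powr 70) powr (1/70) < Dl powr (1/70)"
      using K by (intro powr_less_mono2) (simp_all add: M_def)
    moreover have "(M powr 70) powr (1/70) = M" using M by (simp only: powr_powr) simp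
    ultimately show ?thesis by simp
  qed
  then have "M ^ k < (Dl powr (1/70)) ^ k" using M k by (intro power_strict_mono) simp_all
  then have Mk: "M ^ k < Dl powr (k / 70)" using K by (simp add: powr_power mult.commute)
  have "r ^ k * N \<le> (K * Dl powr (3/2)) ^ k * Dl powr (17/5)"
    using r N K by (intro mult_mono power_mono) simp_all
  also have "\<dots> \<le> (K * Dl powr (3/2)) ^ k * Dl powr (real k * (17/35))"
    using kk K by (intro mult_left_mono powr_mono) simp_all
  also have "\<dots> = K ^ k * Dl powr (k * (3/2)) * Dl powr (real k * (17/35))"
    using K by (simp add: power_mult_distrib powr_power mult.commute)
  finally have "(16 * lam\<^sup>2) ^ k * (r ^ k * N) \<le>
      (16 * lam\<^sup>2) ^ k * (K ^ k * Dl powr (k * (3/2)) * Dl powr (real k * (17/35)))"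
    by (intro mult_left_mono) simp_all
  also have "\<dots> = M ^ k * (Dl powr (k * (3/2)) * Dl powr (real k * (17/35)))"
    by (simp add: M_def power_mult_distrib)
  also have "\<dots> < Dl powr (k / 70) * (Dl powr (k * (3/2)) * Dl powr (real k * (17/35)))"
    using Mk K by (intro mult_strict_right_mono) simp_all
  also have "\<dots> = Dl powr (2 * k)" by (simp add: field_simps flip: powr_add)
  also have "\<dots> = (16 * lam\<^sup>2) ^ k * (Dl / (4 * lam)) ^ (2 * k)"
  proof -
    have "(4 * lam) ^ (2 * k) = (16 * lam\<^sup>2) ^ k"
      by (simp only: power_mult power_mult_distrib) simp
    moreover have "Dl powr (2 * k) = Dl ^ (2 * k)" using K powr_realpow[of Dl "2 * k"] by simp
    moreover have "(16 * lam\<^sup>2) ^ k \<noteq> 0" using lam by simp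
    ultimately show ?thesis by (simp add: power_divide)
  qed
  finally show ?thesis using lam by simp
qed

text \<open>\<open>two_disjoint_ladders\<close> is applied to \<open>A\<close> and the part
  \<open>C\<close> of \<open>B\<close> whose degrees are at most \<open>lam\<close> times the
  average \<open>d\<close>. \<open>H\<close> serves twice: few edges are lost in passing to
  \<open>C\<close>, and \<open>heavy\<close> is small.\<close>

lemma ladder_pair_if_dense:
  fixes adj :: "'v \<Rightarrow> 'v \<Rightarrow> bool" and f ka :: real
  defines "lam \<equiv> 663552 :: real" and "ze \<equiv> (\<Sum>i. real i powr (-33/32))"
  assumes k: "7 \<le> k" and ka: "0 < ka" "ka \<le> 1" "lam\<^sup>2 * (16 * sqrt ka) \<le> 1 / 512"
    and f: "2 \<le> f" "lam\<^sup>2 * (2 * ze * f powr (-1/17)) \<le> 1 / 512"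
      "(16 * lam\<^sup>2 * (64 * k ^ 5 * 17 * (4 / ka))) powr 70 < f"
    and adj: "\<And>x y. adj x y \<Longrightarrow> adj y x" and V: "finite V"
    and H: "\<And>S T. S \<subseteq> V \<Longrightarrow> T \<subseteq> V \<Longrightarrow> edge_count adj S T \<le> f * phi (card S) (card T)"
    and AB: "A \<subseteq> V" "B \<subseteq> V" "A \<noteq> {}" "card A \<le> card B" "card B \<le> card A powr (9/8)"
    and dense: "f / 2 * (card A * card B) powr (3/4) \<le> edge_count adj A B"
  shows "ladder_pair adj (2 * k)"
proof -
  define a where "a = real (card A)"
  define b where "b = real (card B)"
  define e where "e = real (edge_count adj A B)"
  define d where "d = e / b"
  define Dl where "Dl = lam * d"
  have finAB: "finite A" "finite B" using finite_subset[OF AB(1) V] finite_subset[OF AB(2) V] .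
  have "0 < card A" using finAB AB(3) by (simp add: card_gt_0_iff)
  then have a1: "1 \<le> a" by (simp add: a_def)
  have ab: "a \<le> b" "b \<le> a powr (9/8)" using AB(4,5) by (simp_all add: a_def b_def)
  have b1: "1 \<le> b" using a1 ab by simp
  have e_ge: "f / 2 * (a * b) powr (3/4) \<le> e" using dense by (simp add: a_def b_def e_def)
  \<comment> \<open>The balance condition bounds the average degree below by a power of
    \<open>a\<close>; this later limits the number of rungs in terms of \<open>d\<close>.\<close>
  have d_ge: "f / 2 * a powr (15/32) \<le> d"
  proof -
    have "b powr (1/4) \<le> a powr (9/32)"
      using powr_mono2[of "1/4" b "a powr (9/8)"] ab b1 by (simp add: powr_powr)
    then have "b * a powr (15/32) \<le> (b * a) powr (3/4)"
      using a1 b1 by (intro mult_powr_le_powr_mult) simp_all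
    then have "f / 2 * (b * a powr (15/32)) \<le> f / 2 * (a * b) powr (3/4)"
      using f by (intro mult_left_mono) (simp_all add: mult.commute)
    also have "\<dots> \<le> e" by (rule e_ge)
    finally show ?thesis using b1 by (simp add: d_def le_divide_eq mult_ac)
  qed
  have "1 \<le> a powr (15/32)" using a1 by (simp add: ge_one_powr_ge_zero)
  then have "f / 2 * 1 \<le> f / 2 * a powr (15/32)" using f by (intro mult_left_mono) simp_all
  then have df: "f / 2 \<le> d" using d_ge by simp
  then have d1: "1 \<le> d" using f by simp
  then have Dl1: "1 \<le> Dl" and Dlf: "f \<le> Dl" using df by (simp_all add: Dl_def lam_def)
  have e0: "0 < e" using d1 b1 by (simp add: d_def le_divide_eq)
  have ed: "e = b * d" using b1 by (simp add: d_def)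
  define Bh where "Bh = {y \<in> B. Dl < card {x \<in> A. adj x y}}"
  define C where "C = B - Bh"
  have Bh: "Bh \<subseteq> B" "finite Bh" using finAB by (auto simp: Bh_def)
  have split: "real (edge_count adj A C) = e - edge_count adj A Bh"
    using sum.subset_diff[OF Bh(1) finAB(2), of "\<lambda>y. card {x \<in> A. adj x y}"]
    by (simp add: e_def edge_count_def C_def)
  have eh: "edge_count adj A Bh \<le> e / 8"
  proof (rule high_degree_edges[OF a1 ab _ e_ge])
    show "real (card Bh) \<le> b" using Bh finAB by (simp add: b_def card_mono)
    have "edge_count adj A Bh \<le> f * phi (card A) (card Bh)" using H AB Bh by blast
    then show "edge_count adj A Bh \<le> f * phi a (card Bh)" by (simp add: a_def)
    have "(\<Sum>y\<in>Bh. Dl) \<le> (\<Sum>y\<in>Bh. real (card {x \<in> A. adj x y}))"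
      by (intro sum_mono) (auto simp: Bh_def)
    then show "663552 * (e / b) * card Bh \<le> edge_count adj A Bh"
      by (simp add: edge_count_def Dl_def lam_def d_def mult.commute)
  qed (use f in simp_all)
  \<comment> \<open>A quarter of the lower bound \<open>e\<^sup>2 / (a\<^sup>2 * b)\<close> for the
    average codegree in \<open>A\<close>. \<open>Q\<close> is the threshold from
    \<open>heavy_row_bound\<close>.\<close>
  define P where "P = e\<^sup>2 / (4 * a\<^sup>2 * b)"
  define Q where "Q = 4 / ka * f * Dl powr (1/2)"
  have P: "f\<^sup>2 / 16 \<le> P"
  proof -
    have "(f / 2 * (a * b) powr (3/4))\<^sup>2 \<le> e\<^sup>2"
      using e_ge f by (intro power_mono) simp_all
    then have "f\<^sup>2 / 4 * (a * b) powr (3/2) \<le> e\<^sup>2"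
      using a1 b1 by (simp add: power_mult_distrib power_divide powr_power)
    moreover have "a\<^sup>2 * b \<le> (a * b) powr (3/2)"
    proof -
      have "a powr (1/2) * (a powr (3/2) * b) \<le> b powr (1/2) * (a powr (3/2) * b)"
        using a1 b1 ab by (intro mult_right_mono powr_mono2) simp_all
      moreover have "a powr (1/2) * a powr (3/2) = a\<^sup>2" "b powr (1/2) * b = b powr (3/2)"
        using a1 b1 powr_add[of b "1/2" 1] by (simp_all flip: powr_add)
      then have "a\<^sup>2 * b = a powr (1/2) * (a powr (3/2) * b)"
        "(a * b) powr (3/2) = b powr (1/2) * (a powr (3/2) * b)"
        using a1 b1 by (simp_all add: powr_mult mult.left_commute flip: mult.assoc)
      ultimately show ?thesis by (simp only:)
    qed
    ultimately have "f\<^sup>2 / 4 * (a\<^sup>2 * b) \<le> e\<^sup>2"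
      using f by (meson mult_left_mono order_trans zero_le_divide_iff zero_le_power2 zero_le_numeral)
    then show ?thesis using a1 b1 by (simp add: P_def le_divide_eq mult_ac)
  qed
  have P0: "0 < P" using P f by (smt (verit) divide_pos_pos zero_less_power)
  have Q0: "0 \<le> Q" using ka f by (simp add: Q_def)
  interpret bipartite_pair adj A C P Q
    using finAB P0 Q0 adj by unfold_locales (auto simp: C_def)
  have e1: "real (card rungs) = edge_count adj A C"
    by (simp add: card_rungs edge_count_def nbrs_def)
  have e1_ge: "7 / 8 * e \<le> card rungs" and e1_le: "card rungs \<le> e"
    using e1 split eh by simp_all
  have r_ne: "rungs \<noteq> {}"
  proof
    assume "rungs = {}"
    with e1_ge e0 show False by simp
  qed
  then have C_ne: "C \<noteq> {}" by (auto simp: rungs_def)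
  have cC: "0 < real (card C)" "real (card C) \<le> b"
    using C_ne finAB by (auto simp: b_def C_def card_gt_0_iff intro!: card_mono)
  have deg: "card (nbrs y) \<le> Dl" if "y \<in> C" for y
    using that by (auto simp: C_def Bh_def nbrs_def)
  define ep where "ep = 16 * sqrt ka + 2 * ze * f powr (-1/17)"
  have "0 \<le> ze" unfolding ze_def by (rule suminf_nonneg) (simp_all add: summable_real_powr_iff)
  then have ep0: "0 \<le> ep" using ka by (simp add: ep_def)
  have ep: "lam\<^sup>2 * ep \<le> 1 / 256"
    using ka(3) f(2) by (simp add: ep_def distrib_left)
  have "heavy \<le> (\<Sum>y\<in>C. Dl\<^sup>2 * f\<^sup>2 * ep)"
    unfolding heavy_def
  proof (rule sum_mono)
    fix y assume y: "y \<in> C"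
    show "(\<Sum>c\<in>C. if Q < q y c then (q y c)\<^sup>2 else 0) \<le> Dl\<^sup>2 * f\<^sup>2 * ep"
      unfolding ep_def ze_def
    proof (rule heavy_row_bound[OF y _ Dl1 ka(1,2) deg[OF y] _ Q_def])
      fix X assume "X \<subseteq> C"
      then show "edge_count adj (nbrs y) X \<le> f * phi (card (nbrs y)) (card X)"
        using AB by (intro H) (auto simp: nbrs_def C_def)
    qed (use f in simp)
  qed
  also have "\<dots> = card C * (d\<^sup>2 * f\<^sup>2) * (lam\<^sup>2 * ep)"
    by (simp add: Dl_def power_mult_distrib)
  also have "\<dots> \<le> b * (d\<^sup>2 * f\<^sup>2) * (1 / 256)"
    using cC ep ep0 by (intro mult_mono mult_right_mono) simp_all
  finally have "heavy \<le> f\<^sup>2 / 16 * (e * d / 16)" by (simp add: ed power2_eq_square mult_ac)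
  also have "\<dots> \<le> P * (e * d / 16)" using P e0 d1 by (intro mult_right_mono) simp_all
  finally have hv: "heavy / P \<le> e * d / 16" using P0 by (simp add: divide_le_eq mult_ac)
  \<comment> \<open>In units of \<open>e * d\<close> the first term is at least
    \<open>49/64\<close>, the other two are at most \<open>1/4\<close> and \<open>1/16\<close>, and
    \<open>1/4\<close> has to remain.\<close>
  have W: "d / 4 * card rungs \<le> (card rungs)\<^sup>2 / card C - (card A)\<^sup>2 * P - heavy / P"
  proof -
    have "(7 / 8 * e)\<^sup>2 / b \<le> (card rungs)\<^sup>2 / card C"
      using e1_ge e0 cC by (intro frac_le power_mono) simp_all
    moreover have "(7 / 8 * e)\<^sup>2 / b = 49 / 64 * (e * d)" by (simp add: d_def power2_eq_square)
    moreover have "(card A)\<^sup>2 * P = e * d / 4"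
      using a1 by (simp add: P_def d_def power2_eq_square flip: a_def)
    moreover have "d / 4 * card rungs \<le> e * d / 4"
      using mult_left_mono[OF e1_le, of "d / 4"] d1 by (simp add: mult.commute)
    moreover have "0 \<le> e * d" using e0 d1 by simp
    ultimately show ?thesis using hv by linarith
  qed
  define K where "K = 64 * real k ^ 5 * 17 * (4 / ka)"
  have big: "(64 * real k ^ 5 * (1 + Q / P) * Dl) ^ k * card rungs < (d / 4) ^ (2 * k)"
  proof -
    have D12: "1 \<le> Dl powr (1/2)" using Dl1 by (simp add: ge_one_powr_ge_zero)
    have L1: "1 \<le> 4 / ka" using ka by simp
    have "Q / P \<le> Q / (f\<^sup>2 / 16)" using P f Q0 by (intro divide_left_mono) (simp_all add: P0)
    also have "\<dots> = 16 * (4 / ka * Dl powr (1/2)) / f" using f by (simp add: Q_def power2_eq_square)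
    also have "\<dots> \<le> 16 * (4 / ka * Dl powr (1/2)) / 1" using f ka by (intro divide_left_mono) simp_all
    finally have QP: "Q / P \<le> 16 * (4 / ka * Dl powr (1/2))" by simp
    have "1 * 1 \<le> 4 / ka * Dl powr (1/2)" using D12 L1 ka(1) by (intro mult_mono) simp_all
    with QP have "1 + Q / P \<le> 17 * (4 / ka) * Dl powr (1/2)" by simp
    then have "(1 + Q / P) * Dl \<le> 17 * (4 / ka) * Dl powr (1/2) * Dl"
      using Dl1 by (intro mult_right_mono) simp_all
    also have "\<dots> = 17 * (4 / ka) * Dl powr (3/2)"
      using Dl1 powr_add[of Dl "1/2" 1] by simp
    finally have "64 * real k ^ 5 * ((1 + Q / P) * Dl) \<le> 64 * real k ^ 5 * (17 * (4 / ka) * Dl powr (3/2))"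
      by (intro mult_left_mono) simp_all
    then have rle: "64 * real k ^ 5 * (1 + Q / P) * Dl \<le> K * Dl powr (3/2)"
      by (simp add: K_def mult_ac)
    \<comment> \<open>As \<open>15/32 * 12/5 = 9/8\<close>, this yields
      \<open>b <= d powr (12/5)\<close> and so at most \<open>d powr (17/5)\<close> edges.\<close>
    have "a powr (15/32) \<le> d"
      using d_ge f mult_right_mono[of 1 "f / 2" "a powr (15/32)"] by simp
    then have "(a powr (15/32)) powr (12/5) \<le> d powr (12/5)" by (intro powr_mono2) simp_all
    then have "b \<le> d powr (12/5)" using ab by (simp add: powr_powr)
    then have "e \<le> d powr (12/5) * d" unfolding ed using d1 by (intro mult_right_mono) simp_all
    also have "\<dots> = d powr (17/5)" using d1 powr_add[of d "12/5" 1] by simp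
    also have "\<dots> \<le> Dl powr (17/5)" using d1 by (intro powr_mono2) (simp_all add: Dl_def lam_def)
    finally have N: "card rungs \<le> Dl powr (17/5)" using e1_le by simp
    have "(64 * real k ^ 5 * (1 + Q / P) * Dl) ^ k * card rungs < (Dl / (4 * lam)) ^ (2 * k)"
    proof (rule final_inequality[OF k _ _ Dl1 _ _ N _ rle])
      show "(16 * lam\<^sup>2 * K) powr 70 < Dl" using f(3) Dlf by (simp add: K_def)
      show "0 \<le> 64 * real k ^ 5 * (1 + Q / P) * Dl" using Q0 P0 Dl1 by simp
    qed (use ka in \<open>simp_all add: K_def lam_def\<close>)
    then show ?thesis by (simp add: Dl_def lam_def)
  qed
  obtain xs ys where "disjoint_cycle (\<lambda>u. {fst u, snd u}) (2 * k) xs"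
    "disjoint_cycle (\<lambda>u. {fst u, snd u}) (2 * k) ys" "xs ! 0 = ys ! 0"
    "\<forall>i<2*k. \<forall>j<2*k. 0 < i \<longrightarrow> 0 < j \<longrightarrow> {fst (xs ! i), snd (xs ! i)} \<inter> {fst (ys ! j), snd (ys ! j)} = {}"
    using two_disjoint_ladders[OF _ r_ne deg W _ big] k d1 by auto
  then show ?thesis
    unfolding ladder_pair_def by (intro exI[of _ xs] exI[of _ ys] conjI ladder_if_disjoint_cycle)
qed

section \<open>Passing to a dense pair\<close>

text \<open>Discarding an element of at most average value does not lower the average; this is
  repeated until \<open>m\<close> elements remain.\<close>

lemma exists_heavy_subset:
  fixes g :: "'a \<Rightarrow> real"
  assumes "finite T" "m \<le> card T" "\<And>x. x \<in> T \<Longrightarrow> 0 \<le> g x"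
  shows "\<exists>B\<subseteq>T. card B = m \<and> m * sum g T \<le> card T * sum g B"
  using assms
proof (induction "card T" arbitrary: T)
  case 0
  then show ?case by auto
next
  case (Suc n)
  show ?case
  proof (cases "m = Suc n \<or> m = 0")
    case True
    then show ?thesis
    proof
      assume "m = 0"
      then show ?thesis using Suc.prems by (intro exI[of _ "{}"]) auto
    qed (use Suc in auto)
  next
    case False
    then have m: "m \<le> n" "0 < n" using Suc.prems(2) Suc.hyps(2) by auto
    have "\<exists>x\<in>T. Suc n * g x \<le> sum g T"
    proof (rule ccontr)
      assume "\<not> ?thesis"
      then have "(\<Sum>x\<in>T. sum g T) < (\<Sum>x\<in>T. Suc n * g x)"
        using Suc.prems(1) Suc.hyps(2) by (intro sum_strict_mono) (auto simp: not_le)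
      then show False by (simp only: sum_constant Suc.hyps(2)[symmetric] sum_distrib_left[symmetric])
    qed
    then obtain x where x: "x \<in> T" "Suc n * g x \<le> sum g T" by blast
    have n: "card (T - {x}) = n" using Suc.hyps(2) Suc.prems(1) x(1) by simp
    obtain B where B: "B \<subseteq> T - {x}" "card B = m" "m * sum g (T - {x}) \<le> n * sum g B"
      using Suc.hyps(1)[of "T - {x}"] n m Suc.prems(1,3) by auto
    have "n * sum g T \<le> Suc n * sum g (T - {x})"
      using x Suc.prems(1) by (simp add: sum_diff1 algebra_simps)
    then have "m * (n * sum g T) \<le> m * (Suc n * sum g (T - {x}))" by (intro mult_left_mono) simp_all
    also have "\<dots> = Suc n * (m * sum g (T - {x}))" by (simp only: mult_ac)
    also have "\<dots> \<le> Suc n * (n * sum g B)" using B(3) by (intro mult_left_mono) simp_all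
    finally have "n * (m * sum g T) \<le> n * (Suc n * sum g B)" by (simp only: mult_ac)
    then have "m * sum g T \<le> Suc n * sum g B" using m(2) by (simp add: mult_le_cancel_left)
    then show ?thesis using B Suc.hyps(2) by (intro exI[of _ B]) auto
  qed
qed

lemma edge_count_commute:
  assumes "finite S" "finite T" "\<And>x y. adj x y \<Longrightarrow> adj y x"
  shows "edge_count adj S T = edge_count adj T S"
proof -
  have *: "edge_count adj S T = card (SIGMA y:T. {x \<in> S. adj x y})" if "finite S" "finite T" for S T
    using that by (simp add: edge_count_def)
  have "bij_betw prod.swap (SIGMA y:T. {x \<in> S. adj x y}) (SIGMA y:S. {x \<in> T. adj x y})"
    using assms(3) by (intro bij_betwI[where g = prod.swap]) auto
  then show ?thesis unfolding *[OF assms(1,2)] *[OF assms(2,1)] by (rule bij_betw_same_card)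
qed

lemma phi_commute: "phi s t = phi t s"
  by (simp add: phi_def mult.commute)

lemma phi_nonneg: "0 \<le> s \<Longrightarrow> 0 \<le> t \<Longrightarrow> 0 \<le> phi s t"
  by (simp add: phi_def)

lemma phi_diag_le: "1 \<le> n \<Longrightarrow> phi n n \<le> 3 * n powr (3/2)"
proof -
  assume n: "1 \<le> n"
  have "n * n powr (15/32) = n powr (47/32)" using n powr_add[of n 1 "15/32"] by simp
  also have "\<dots> \<le> n powr (3/2)" using n by (intro powr_mono) simp_all
  moreover have "(n * n) powr (3/4) = n powr (3/2)" using n by (simp add: powr_mult flip: powr_add)
  ultimately show ?thesis by (simp add: phi_def)
qed

text \<open>If \<open>T\<close> is too large, about \<open>card S powr (9/8)\<close> of its vertices
  with at least average degree are kept. The summand \<open>t * s powr (15/32)\<close> of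
  \<open>phi\<close> guarantees enough edges between them and \<open>S\<close>, as
  \<open>9/8 + 15/32 = 3/4 * (1 + 9/8)\<close>.\<close>

lemma balanced_near_maximizer:
  fixes adj :: "'v \<Rightarrow> 'v \<Rightarrow> bool" and f :: real
  assumes S: "finite S" "S \<noteq> {}" "finite T" "card S \<le> card T"
    and f: "0 < f" and max: "edge_count adj S T = f * phi (card S) (card T)"
  shows "\<exists>B\<subseteq>T. card S \<le> card B \<and> card B \<le> card S powr (9/8) \<and>
    f / 2 * (card S * card B) powr (3/4) \<le> edge_count adj S B"
proof -
  define a t where "a = real (card S)" and "t = real (card T)"
  have "0 < card S" using S by (simp add: card_gt_0_iff)
  then have a1: "1 \<le> a" by (simp add: a_def)
  have at: "a \<le> t" using S by (simp add: a_def t_def)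
  show ?thesis
  proof (cases "t \<le> a powr (9/8)")
    case True
    have "(a * t) powr (3/4) \<le> phi a t" using a1 at by (simp add: phi_def)
    then have "f * (a * t) powr (3/4) \<le> f * phi a t" using f by simp
    moreover have "f / 2 * (a * t) powr (3/4) \<le> f * (a * t) powr (3/4)" using f by simp
    ultimately show ?thesis using True S max by (intro exI[of _ T]) (simp add: a_def t_def)
  next
    case False
    define m where "m = nat \<lfloor>a powr (9/8)\<rfloor>"
    have a98: "a \<le> a powr (9/8)" using a1 powr_mono[of 1 "9/8" a] by simp
    have m_le: "real m \<le> a powr (9/8)" by (simp add: m_def)
    have m_ge: "card S \<le> m" using a98 by (simp add: m_def a_def le_nat_floor)
    \<comment> \<open>Rounding down costs at most a factor \<open>2\<close>, because
      \<open>m\<close> is at least \<open>1\<close>.\<close>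
    have "a powr (9/8) < real m + 1" using a98 a1 unfolding m_def by linarith
    moreover have "1 \<le> real m" using m_ge \<open>0 < card S\<close> by simp
    ultimately have m_half: "a powr (9/8) \<le> 2 * real m" by simp
    have "m \<le> card T" using m_le False by (simp add: t_def)
    then obtain B where B: "B \<subseteq> T" "card B = m"
      "m * edge_count adj S T \<le> card T * edge_count adj S B"
      using exists_heavy_subset[of T m "\<lambda>y. real (card {x \<in> S. adj x y})"] S
      by (auto simp: edge_count_def simp flip: of_nat_sum of_nat_mult)
    have "t * (f * (m * a powr (15/32))) \<le> m * (f * phi a t)"
      using f a1 at by (simp add: phi_def distrib_left mult_ac)
    also have "\<dots> \<le> t * edge_count adj S B"
      using of_nat_mono[OF B(3), where ?'a = real] max by (simp add: a_def t_def)
    finally have "f * (m * a powr (15/32)) \<le> edge_count adj S B" using a1 at by simp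
    moreover have "f / 2 * (a * m) powr (3/4) \<le> f * (m * a powr (15/32))"
    proof -
      have "(a powr (9/8)) powr (1/4) \<le> (2 * real m) powr (1/4)"
        using m_half by (intro powr_mono2) simp_all
      also have "\<dots> = 2 powr (1/4) * m powr (1/4)" by (simp add: powr_mult)
      also have "\<dots> \<le> 2 powr 1 * m powr (1/4)" by (intro mult_right_mono powr_mono) simp_all
      finally have *: "a powr (9/32) \<le> 2 * m powr (1/4)" by (simp add: powr_powr)
      have "a powr (3/4) * m powr (3/4) = (a powr (9/32) * a powr (15/32)) * m powr (3/4)"
        by (simp flip: powr_add)
      also have "\<dots> \<le> ((2 * m powr (1/4)) * a powr (15/32)) * m powr (3/4)"
        using * by (intro mult_right_mono) simp_all
      also have "\<dots> = 2 * (m powr (1/4) * m powr (3/4)) * a powr (15/32)" by (simp only: mult_ac)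
      also have "m powr (1/4) * m powr (3/4) = real m" by (simp flip: powr_add)
      finally show ?thesis using f a1 by (simp add: powr_mult)
    qed
    ultimately show ?thesis using B m_le m_ge by (intro exI[of _ B]) (simp add: a_def)
  qed
qed

text \<open>\<open>f\<close> is the largest ratio of \<open>edge_count\<close> to \<open>phi\<close>
  over nonempty pairs. If the bound fails, the pair \<open>(V, V)\<close> makes \<open>f\<close>
  large (the \<open>3\<close> comes from \<open>phi_diag_le\<close>), and a maximising pair leads to
  the hypotheses of \<open>ladder_pair_if_dense\<close>.\<close>

lemma edge_count_bound_if_no_ladder_pair:
  assumes k: "7 \<le> k"
  shows "\<exists>K. \<forall>adj (V :: 'v set). finite V \<longrightarrow> (\<forall>x y. adj x y \<longrightarrow> adj y x) \<longrightarrow>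
    \<not> ladder_pair adj (2 * k) \<longrightarrow> edge_count adj V V \<le> K * real (card V) powr (3/2)"
proof -
  define lam :: real where "lam = 663552"
  define ze where "ze = (\<Sum>i. real i powr (-33/32))"
  \<comment> \<open>Chosen so that \<open>lam\<^sup>2 * (16 * sqrt ka)\<close> equals
    \<open>1 / 512\<close>.\<close>
  define ka where "ka = (1 / (8192 * lam\<^sup>2))\<^sup>2"
  have lam0: "0 < lam" by (simp add: lam_def)
  have "sqrt ka = 1 / (8192 * lam\<^sup>2)"
    unfolding ka_def real_sqrt_abs using lam0 by simp
  then have ka: "lam\<^sup>2 * (16 * sqrt ka) \<le> 1 / 512" "0 < ka"
    using lam0 by (simp_all add: ka_def)
  have ka1: "ka \<le> 1" unfolding ka_def by (intro power_le_one) (simp_all add: lam_def)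
  \<comment> \<open>With \<open>ka\<close> fixed, the remaining conditions on \<open>f\<close> hold
    eventually; \<open>F\<close> is a common threshold.\<close>
  have "((\<lambda>f :: real. f powr (-1/17)) \<longlongrightarrow> 0) at_top"
    by (rule tendsto_neg_powr) (simp_all add: filterlim_ident)
  then have "((\<lambda>f. lam\<^sup>2 * (2 * ze * f powr (-1/17))) \<longlongrightarrow> lam\<^sup>2 * (2 * ze * 0)) at_top"
    by (intro tendsto_mult_left)
  then have "eventually (\<lambda>f. lam\<^sup>2 * (2 * ze * f powr (-1/17)) < 1 / 512) at_top"
    by (rule order_tendstoD(2)) simp
  then have "eventually (\<lambda>f. lam\<^sup>2 * (2 * ze * f powr (-1/17)) \<le> 1 / 512) at_top"
    by (rule eventually_mono) simp
  then have "eventually (\<lambda>f. 2 \<le> f \<and> lam\<^sup>2 * (2 * ze * f powr (-1/17)) \<le> 1 / 512 \<and>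
      (16 * lam\<^sup>2 * (64 * real k ^ 5 * 17 * (4 / ka))) powr 70 < f) at_top"
    by (intro eventually_conj eventually_ge_at_top eventually_gt_at_top)
  then obtain F where F: "\<And>f. F \<le> f \<Longrightarrow> 2 \<le> f \<and> lam\<^sup>2 * (2 * ze * f powr (-1/17)) \<le> 1 / 512 \<and>
      (16 * lam\<^sup>2 * (64 * real k ^ 5 * 17 * (4 / ka))) powr 70 < f"
    by (auto simp: eventually_at_top_linorder)
  have F2: "2 \<le> F" using F by blast
  have "edge_count adj V V \<le> 3 * F * real (card V) powr (3/2)"
    if V: "finite V" and adj: "\<And>x y. adj x y \<Longrightarrow> adj y x" and no: "\<not> ladder_pair adj (2 * k)"
    for adj and V :: "'v set"
  proof (rule ccontr)
    assume large: "\<not> ?thesis"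
    then have "V \<noteq> {}" by (auto simp: edge_count_def)
    then have "0 < card V" using V by (simp add: card_gt_0_iff)
    define P where "P = (Pow V - {{}}) \<times> (Pow V - {{}})"
    define r where "r = (\<lambda>(S, T). edge_count adj S T / phi (card S) (card T))"
    define f where "f = Max (r ` P)"
    have P: "finite P" "(V, V) \<in> P" using V \<open>V \<noteq> {}\<close> by (auto simp: P_def)
    have pos: "0 < phi (card S) (card T)" if "(S, T) \<in> P" for S T
    proof -
      have "0 < card S" "0 < card T" using that V by (auto simp: P_def card_gt_0_iff intro: finite_subset)
      then have "0 < (real (card S) * real (card T)) powr (3/4)" by simp
      then show ?thesis unfolding phi_def by (intro add_pos_nonneg) simp_all
    qed
    have rf: "r p \<le> f" if "p \<in> P" for p using that P by (simp add: f_def)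
    have "F < r (V, V)"
    proof -
      have "F * phi (card V) (card V) \<le> F * (3 * real (card V) powr (3/2))"
        using F2 \<open>0 < card V\<close> by (intro mult_left_mono phi_diag_le) simp_all
      also have "\<dots> < edge_count adj V V" using large by (simp add: mult_ac)
      finally show ?thesis using pos[OF P(2)] by (simp add: r_def less_divide_eq)
    qed
    then have fF: "F \<le> f" using rf[OF P(2)] by simp
    then have f0: "0 < f" using F2 by simp
    have H: "edge_count adj S T \<le> f * phi (card S) (card T)" if "S \<subseteq> V" "T \<subseteq> V" for S T
    proof (cases "S = {} \<or> T = {}")
      case True
      then have "edge_count adj S T = 0" by (auto simp: edge_count_def)
      then show ?thesis using f0 by (simp add: phi_nonneg)
    next
      case False
      then have "(S, T) \<in> P" using that by (simp add: P_def)
      then show ?thesis using rf[of "(S, T)"] pos[of S T] by (simp add: r_def divide_le_eq)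
    qed
    have "f \<in> r ` P" unfolding f_def using P by (intro Max_in) auto
    then obtain S T where ST: "(S, T) \<in> P" "f = r (S, T)" by auto
    then have eq: "edge_count adj S T = f * phi (card S) (card T)"
      using pos[of S T] by (simp add: r_def)
    have fin: "finite S" "finite T" "S \<noteq> {}" "T \<noteq> {}" "S \<subseteq> V" "T \<subseteq> V"
      using ST(1) V by (auto simp: P_def intro: finite_subset)
    obtain S' T' where ST': "finite S'" "S' \<noteq> {}" "finite T'" "card S' \<le> card T'" "S' \<subseteq> V" "T' \<subseteq> V"
      "edge_count adj S' T' = f * phi (card S') (card T')"
    proof (cases "card S \<le> card T")
      case True
      then show ?thesis using that[of S T] fin eq by simp
    next
      case False
      then show ?thesis
        using that[of T S] fin eq edge_count_commute[OF fin(1,2) adj] by (simp add: phi_commute)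
    qed
    obtain B where B: "B \<subseteq> T'" "card S' \<le> card B" "card B \<le> card S' powr (9/8)"
      "f / 2 * (card S' * card B) powr (3/4) \<le> edge_count adj S' B"
      using balanced_near_maximizer[OF ST'(1-4) f0 ST'(7)] by blast
    have "ladder_pair adj (2 * k)"
    proof (rule ladder_pair_if_dense[OF k ka(2) ka1 _ _ _ _ adj V H ST'(5) _ ST'(2) B(2,3,4)])
      show "B \<subseteq> V" using B(1) ST'(6) by blast
    qed (use F[OF fF] ka(1) in \<open>auto simp: lam_def ze_def\<close>)
    then show False using no by blast
  qed
  then show ?thesis by blast
qed

section \<open>From ladders to the bowtie graph\<close>

lemma contains_copyI:
  assumes G: "simple_graph G" and inj: "inj_on f (verts H)" and V: "f ` verts H \<subseteq> verts G"
    and sub: "\<And>e. e \<in> edges H \<Longrightarrow> e \<subseteq> verts H" and E: "\<And>e. e \<in> edges H \<Longrightarrow> f ` e \<in> edges G"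
  shows "contains_copy G H"
proof -
  define S where "S = \<lparr>verts = f ` verts H, edges = (`) f ` edges H\<rparr>"
  have "finite (verts S)" using finite_subset[OF V] G by (simp add: S_def simple_graph_def)
  moreover have SE: "e \<subseteq> verts S \<and> e \<in> edges G" if e: "e \<in> edges S" for e
  proof -
    obtain e0 where e0: "e0 \<in> edges H" "e = f ` e0" using e by (auto simp: S_def)
    then show ?thesis using E[OF e0(1)] image_mono[OF sub[OF e0(1)], of f] by (simp add: S_def)
  qed
  moreover have "card e = 2" if "e \<in> edges G" for e using that G by (simp add: simple_graph_def)
  ultimately have "is_subgraph S G"
    unfolding is_subgraph_def simple_graph_def using V by (simp add: subset_iff S_def)
  moreover have "{u, v} \<in> edges H \<longleftrightarrow> {f u, f v} \<in> edges S" if "u \<in> verts H" "v \<in> verts H" for u v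
  proof
    assume "{f u, f v} \<in> edges S"
    then obtain e where e: "e \<in> edges H" "f ` {u, v} = f ` e" by (auto simp: S_def)
    then have "{u, v} = e" using inj_on_image_eq_iff[OF inj, of "{u, v}" e] that sub[OF e(1)] by simp
    then show "{u, v} \<in> edges H" using e by simp
  qed (auto simp: S_def intro: image_eqI[of _ _ "{u, v}"])
  then have "graph_iso H S"
    unfolding graph_iso_def using inj by (intro exI[of _ f]) (auto simp: S_def bij_betw_def)
  ultimately show ?thesis by (auto simp: contains_copy_def)
qed

lemma contains_copyE:
  assumes "contains_copy G H" "\<And>e. e \<in> edges H \<Longrightarrow> \<exists>u\<in>verts H. \<exists>v\<in>verts H. e = {u, v}"
  obtains f where "inj_on f (verts H)" "f ` verts H \<subseteq> verts G" "\<And>e. e \<in> edges H \<Longrightarrow> f ` e \<in> edges G"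
proof -
  obtain S f where S: "is_subgraph S G" and f: "bij_betw f (verts H) (verts S)"
    "\<And>u v. u \<in> verts H \<Longrightarrow> v \<in> verts H \<Longrightarrow> {u, v} \<in> edges H \<longleftrightarrow> {f u, f v} \<in> edges S"
    using assms(1) by (auto simp: contains_copy_def graph_iso_def)
  have "f ` e \<in> edges G" if e: "e \<in> edges H" for e
  proof -
    obtain u v where "u \<in> verts H" "v \<in> verts H" "e = {u, v}" using assms(2)[OF e] by blast
    then have "f ` e \<in> edges S" using f(2) e by auto
    then show ?thesis using S by (auto simp: is_subgraph_def)
  qed
  moreover have "inj_on f (verts H)" "f ` verts H \<subseteq> verts G"
    using f(1) S by (auto simp: bij_betw_def is_subgraph_def)
  ultimately show ?thesis using that by blast
qed

section \<open>Vertices and edges of the prism and bowtie graphs\<close>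

lemma prism_edge_cases:
  assumes "e \<in> edges (prism_graph l)"
  obtains i where "i < 2 * l" "e = {(i, 0), (i, 1)}"
  | i c where "i < 2 * l" "c < 2" "e = {(i, c), (Suc i mod (2 * l), c)}"
proof -
  consider u v v' where "e = {(u, v), (u, v')}" "u < 2 * l" "{v, v'} \<subseteq> {..<2 :: nat}" "card {v, v'} = 2"
    | u u' v i where "e = {(u, v), (u', v)}" "v < 2" "{u, u'} = {i, (i + 1) mod (2 * l)}" "i < 2 * l"
    using assms
    by (auto simp: prism_graph_def cartesian_product_def cycle_graph_def complete_graph_def)
  then show ?thesis
  proof cases
    case 1
    then have "(v = 0 \<and> v' = 1) \<or> (v = 1 \<and> v' = 0)" by (auto simp: card_insert_if less_2_cases_iff)
    then show ?thesis using 1 that(1)[of u] by (auto simp: insert_commute)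
  next
    case 2
    have "e = (\<lambda>x. (x, v)) ` {u, u'}" unfolding 2(1) by simp
    also have "\<dots> = {(i, v), (Suc i mod (2 * l), v)}" unfolding 2(3) by simp
    finally show ?thesis using 2 that(2)[of i v] by simp
  qed
qed

lemma rung_in_prism:
  assumes "i < 2 * l"
  shows "{(i, 0), (i, 1)} \<in> edges (prism_graph l)"
proof -
  have "i \<in> verts (cycle_graph (2 * l))" "{0, 1} \<in> edges (complete_graph 2)"
    using assms by (auto simp: cycle_graph_def complete_graph_def)
  then show ?thesis unfolding prism_graph_def cartesian_product_def by auto
qed

lemma verts_prism: "verts (prism_graph l) = {..<2 * l} \<times> {..<2}"
  by (simp add: prism_graph_def cartesian_product_def cycle_graph_def complete_graph_def)

lemma prism_edge_ends:
  assumes "e \<in> edges (prism_graph l)"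
  shows "\<exists>u\<in>verts (prism_graph l). \<exists>v\<in>verts (prism_graph l). e = {u, v}"
  using assms
proof (cases rule: prism_edge_cases)
  case (1 i)
  show ?thesis unfolding 1(2)
    using 1(1) by (intro bexI[of _ "(i, 0)"] bexI[of _ "(i, 1)"]) (simp_all add: verts_prism)
next
  case (2 i c)
  show ?thesis unfolding 2(3)
    using 2(1,2) by (intro bexI[of _ "(i, c)"] bexI[of _ "(Suc i mod (2 * l), c)"]) (simp_all add: verts_prism)
qed

lemma verts_bowtie:
  "verts (bowtie_graph l) = identify_on glued_edge ` (verts (prism_graph l) <+> verts (prism_graph l))"
  by (simp add: bowtie_graph_def glue_copies_def disjoint_copies_def)

lemma verts_bowtie':
  "verts (bowtie_graph l) = Inl ` verts (prism_graph l) \<union> Inr ` (verts (prism_graph l) - glued_edge)"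
  unfolding verts_bowtie Plus_def by (auto simp: identify_on_def image_Un image_image)

lemma edges_bowtie:
  "edges (bowtie_graph l) = (\<lambda>e. identify_on glued_edge ` Inl ` e) ` edges (prism_graph l) \<union>
     (\<lambda>e. identify_on glued_edge ` Inr ` e) ` edges (prism_graph l)"
  by (simp add: bowtie_graph_def glue_copies_def disjoint_copies_def image_Un image_image)

lemma bowtie_edgeI:
  assumes "e \<in> edges (prism_graph l)"
  shows "identify_on glued_edge ` Inl ` e \<in> edges (bowtie_graph l)"
    and "identify_on glued_edge ` Inr ` e \<in> edges (bowtie_graph l)"
  using assms unfolding edges_bowtie by blast+

lemma bowtie_edge_ends:
  assumes "e \<in> edges (bowtie_graph l)"
  shows "\<exists>u\<in>verts (bowtie_graph l). \<exists>v\<in>verts (bowtie_graph l). e = {u, v}"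
proof -
  let ?c = "identify_on glued_edge"
  obtain e0 and h :: "nat \<times> nat \<Rightarrow> (nat \<times> nat) + (nat \<times> nat)"
    where e: "e0 \<in> edges (prism_graph l)" "e = ?c ` h ` e0" and h: "h = Inl \<or> h = Inr"
    using assms unfolding edges_bowtie by blast
  obtain u v where uv: "u \<in> verts (prism_graph l)" "v \<in> verts (prism_graph l)" "e0 = {u, v}"
    using prism_edge_ends[OF e(1)] by blast
  then have "?c (h u) \<in> verts (bowtie_graph l)" "?c (h v) \<in> verts (bowtie_graph l)"
    using h by (auto simp: verts_bowtie)
  then show ?thesis using e(2) uv(3) by auto
qed

text \<open>
  A ladder alternates sides: position \<open>(i, c)\<close> of the prism is the first or the second endpoint of
  the \<open>i\<close>-th rung according to the parity of \<open>i + c\<close>.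
\<close>

definition ladder_vertex :: "('v \<times> 'v) list \<Rightarrow> nat \<times> nat \<Rightarrow> 'v" where
  "ladder_vertex xs z = (if even (fst z + snd z) then fst (xs ! fst z) else snd (xs ! fst z))"

lemma ladder_vertex_edge:
  assumes xs: "ladder adj (2 * l) xs" and adj: "\<And>x y. adj x y \<Longrightarrow> {x, y} \<in> E"
    and e: "e \<in> edges (prism_graph l)"
  shows "ladder_vertex xs ` e \<in> E"
  using e
proof (cases rule: prism_edge_cases)
  case (1 i)
  have "adj (fst (xs ! i)) (snd (xs ! i))" using xs 1 by (simp add: ladder_def)
  moreover have "ladder_vertex xs ` e = {fst (xs ! i), snd (xs ! i)}"
    unfolding 1 by (cases "even i") (auto simp: ladder_vertex_def)
  ultimately show ?thesis using adj by simp
next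
  case (2 i c)
  let ?j = "Suc i mod (2 * l)"
  have "adj (fst (xs ! i)) (snd (xs ! ?j))" "adj (fst (xs ! ?j)) (snd (xs ! i))"
    using xs 2 by (simp_all add: ladder_def)
  then have "{fst (xs ! i), snd (xs ! ?j)} \<in> E" "{fst (xs ! ?j), snd (xs ! i)} \<in> E" by (simp_all add: adj)
  \<comment> \<open>As \<open>2 * l\<close> is even, the wrap-around from the last rung to the first
    changes parity too.\<close>
  moreover have "even ?j \<longleftrightarrow> odd i" by (simp add: dvd_mod_iff)
  ultimately show ?thesis unfolding 2(3)
    by (cases "even (i + c)") (simp_all add: ladder_vertex_def insert_commute)
qed

text \<open>Disjointness of the rungs determines \<open>i\<close>; irreflexivity then tells the two
  ends of the rung apart.\<close>

lemma ladder_vertex_inj: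
  assumes xs: "ladder adj (2 * l) xs" and irrefl: "\<And>x. \<not> adj x x"
  shows "inj_on (ladder_vertex xs) (verts (prism_graph l))"
proof (rule inj_onI)
  fix z z' assume z: "z \<in> verts (prism_graph l)" "z' \<in> verts (prism_graph l)"
    and eq: "ladder_vertex xs z = ladder_vertex xs z'"
  obtain i c j c' where ij: "z = (i, c)" "z' = (j, c')" by (cases z; cases z')
  have ic: "i < 2 * l" "j < 2 * l" "c < 2" "c' < 2" using z ij by (auto simp: verts_prism)
  have "ladder_vertex xs z \<in> {fst (xs ! i), snd (xs ! i)}" "ladder_vertex xs z' \<in> {fst (xs ! j), snd (xs ! j)}"
    by (auto simp: ladder_vertex_def ij)
  then have "i = j" using xs ic eq unfolding ladder_def by fastforce
  moreover have "fst (xs ! i) \<noteq> snd (xs ! i)" using xs ic irrefl by (metis ladder_def)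
  ultimately have "c = c'"
    using eq ij ic by (auto simp: ladder_vertex_def less_2_cases_iff split: if_splits)
  with \<open>i = j\<close> show "z = z'" by (simp add: ij)
qed

lemma contains_bowtie_if_ladder_pair:
  assumes G: "simple_graph G" and lp: "ladder_pair (\<lambda>u v. {u, v} \<in> edges G) (2 * l)"
  shows "contains_copy G (bowtie_graph l)"
proof -
  let ?adj = "\<lambda>u v. {u, v} \<in> edges G" and ?c = "identify_on glued_edge" and ?V = "verts (prism_graph l)"
  obtain xs ys where xs: "ladder ?adj (2 * l) xs" and ys: "ladder ?adj (2 * l) ys" and xy: "xs ! 0 = ys ! 0"
    and disj: "\<forall>i<2*l. \<forall>j<2*l. 0 < i \<longrightarrow> 0 < j \<longrightarrow>
      {fst (xs ! i), snd (xs ! i)} \<inter> {fst (ys ! j), snd (ys ! j)} = {}"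
    using lp unfolding ladder_pair_def by (elim exE conjE)
  have dis: "{fst (xs ! i), snd (xs ! i)} \<inter> {fst (ys ! j), snd (ys ! j)} = {}"
    if "i < 2 * l" "j < 2 * l" "0 < i" "0 < j" for i j
    using disj that by (simp only:)
  have irrefl: "\<not> ?adj x x" for x using G by (auto simp: simple_graph_def)
  define f where "f = case_sum (ladder_vertex xs) (ladder_vertex ys)"
  \<comment> \<open>The two ladders agree on the glued edge because
    \<open>xs ! 0 = ys ! 0\<close>.\<close>
  have f: "f (?c (Inl z)) = ladder_vertex xs z" "f (?c (Inr z)) = ladder_vertex ys z" for z
    using xy by (auto simp: f_def identify_on_def glued_edge_def ladder_vertex_def)
  \<comment> \<open>For \<open>z\<close> on the common rung this is injectivity of
    \<open>ladder_vertex ys\<close>; otherwise both rungs lie beyond position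
    \<open>0\<close>.\<close>
  have cross: "ladder_vertex xs z \<noteq> ladder_vertex ys z'"
    if z: "z \<in> ?V" "z' \<in> ?V" "z' \<notin> glued_edge" for z z'
  proof
    assume eq: "ladder_vertex xs z = ladder_vertex ys z'"
    obtain i c j c' where ij: "z = (i, c)" "z' = (j, c')" by (cases z; cases z')
    have ic: "i < 2 * l" "j < 2 * l" "c < 2" "c' < 2" using z ij by (auto simp: verts_prism)
    have j: "0 < j" using z(3) ij ic by (auto simp: glued_edge_def less_2_cases_iff)
    show False
    proof (cases "i = 0")
      case True
      then have "xs ! fst z = ys ! fst z" using ij xy by simp
      then have "ladder_vertex xs z = ladder_vertex ys z" unfolding ladder_vertex_def by simp
      with eq have "ladder_vertex ys z = ladder_vertex ys z'" by simp
      then have "z = z'" using ladder_vertex_inj[OF ys irrefl] z by (simp add: inj_on_def)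
      then show False using True j ij by simp
    next
      case False
      have "ladder_vertex xs z \<in> {fst (xs ! i), snd (xs ! i)}" "ladder_vertex ys z' \<in> {fst (ys ! j), snd (ys ! j)}"
        by (auto simp: ladder_vertex_def ij)
      then show False using dis[OF ic(1,2) _ j] False eq by auto
    qed
  qed
  have inj: "inj_on f (verts (bowtie_graph l))"
  proof -
    have f_o: "f \<circ> Inl = ladder_vertex xs" "f \<circ> Inr = ladder_vertex ys"
      by (simp_all add: f_def case_sum_o_inj)
    have l: "inj_on f (Inl ` ?V)"
      by (rule inj_on_imageI) (simp only: f_o ladder_vertex_inj[OF xs irrefl])
    have "inj_on f (Inr ` ?V)"
      by (rule inj_on_imageI) (simp only: f_o ladder_vertex_inj[OF ys irrefl])
    then have r: "inj_on f (Inr ` (?V - glued_edge))" by (rule inj_on_subset) blast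
    have "f ` Inl ` ?V \<inter> f ` Inr ` (?V - glued_edge) = {}"
      unfolding image_comp f_o using cross by blast
    then show ?thesis unfolding verts_bowtie' inj_on_Un using l r by blast
  qed
  have E: "f ` e \<in> edges G" if "e \<in> edges (bowtie_graph l)" for e
  proof -
    obtain e0 where e0: "e0 \<in> edges (prism_graph l)" "e = ?c ` Inl ` e0 \<or> e = ?c ` Inr ` e0"
      using \<open>e \<in> edges (bowtie_graph l)\<close> unfolding edges_bowtie by blast
    then have "f ` e = ladder_vertex xs ` e0 \<or> f ` e = ladder_vertex ys ` e0"
      by (elim disjE) (simp_all add: image_image f)
    moreover have "ladder_vertex xs ` e0 \<in> edges G" "ladder_vertex ys ` e0 \<in> edges G"
      using ladder_vertex_edge[OF xs _ e0(1), of "edges G"] ladder_vertex_edge[OF ys _ e0(1), of "edges G"] by simp_all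
    ultimately show ?thesis by metis
  qed
  \<comment> \<open>Ladders speak of adjacency only. Their vertices belong to \<open>G\<close>
    because each vertex of the bowtie graph lies on an edge.\<close>
  have on_edge: "\<exists>e\<in>edges (bowtie_graph l). z \<in> e" if z: "z \<in> verts (bowtie_graph l)" for z
  proof -
    obtain u where u: "u \<in> ?V" "z = ?c (Inl u) \<or> z = ?c (Inr u)"
      using z unfolding verts_bowtie Plus_def by blast
    obtain i c where ic: "u = (i, c)" "i < 2 * l" "c < 2" using u(1) by (cases u) (auto simp: verts_prism)
    have "{(i, 0), (i, 1)} \<in> edges (prism_graph l)" using ic(2) by (rule rung_in_prism)
    note ends = bowtie_edgeI[OF this]
    have uin: "u \<in> {(i, 0), (i, 1)}" using ic by (auto simp: less_2_cases_iff)
    show ?thesis using u(2)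
    proof
      assume "z = ?c (Inl u)"
      then have "z \<in> ?c ` Inl ` {(i, 0), (i, 1)}" using uin by (simp only: imageI)
      with ends(1) show ?thesis by (rule bexI[rotated])
    next
      assume "z = ?c (Inr u)"
      then have "z \<in> ?c ` Inr ` {(i, 0), (i, 1)}" using uin by (simp only: imageI)
      with ends(2) show ?thesis by (rule bexI[rotated])
    qed
  qed
  have V: "f ` verts (bowtie_graph l) \<subseteq> verts G"
  proof
    fix y assume "y \<in> f ` verts (bowtie_graph l)"
    then obtain z where z: "z \<in> verts (bowtie_graph l)" "y = f z" by blast
    then obtain e where e: "e \<in> edges (bowtie_graph l)" "z \<in> e" using on_edge by metis
    from E[OF e(1)] have "f ` e \<subseteq> verts G" using G by (simp add: simple_graph_def)
    then show "y \<in> verts G" using z e by blast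
  qed
  show ?thesis
  proof (rule contains_copyI[OF G inj V _ E])
    fix e assume "e \<in> edges (bowtie_graph l)"
    then obtain u v where "u \<in> verts (bowtie_graph l)" "v \<in> verts (bowtie_graph l)" "e = {u, v}"
      using bowtie_edge_ends by metis
    then show "e \<subseteq> verts (bowtie_graph l)" by simp
  qed
qed

text \<open>\<open>edge_count\<close> runs over ordered pairs, which map onto the edges.\<close>

lemma card_edges_le_edge_count:
  assumes "simple_graph G"
  shows "card (edges G) \<le> edge_count (\<lambda>u v. {u, v} \<in> edges G) (verts G) (verts G)"
proof -
  let ?P = "SIGMA y:verts G. {x \<in> verts G. {x, y} \<in> edges G}"
  have fin: "finite (verts G)" using assms by (simp add: simple_graph_def)
  have "edges G \<subseteq> (\<lambda>(y, x). {x, y}) ` ?P"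
  proof
    fix e assume e: "e \<in> edges G"
    then have "e \<subseteq> verts G" "card e = 2" using assms by (auto simp: simple_graph_def)
    then obtain x y where "e = {x, y}" "x \<in> verts G" "y \<in> verts G" by (auto simp: card_2_iff)
    then show "e \<in> (\<lambda>(y, x). {x, y}) ` ?P" using e by force
  qed
  moreover have "finite ?P" using fin by simp
  ultimately have "card (edges G) \<le> card ?P" by (rule surj_card_le[rotated])
  then show ?thesis using fin by (simp add: edge_count_def)
qed

section \<open>Extremal numbers\<close>

definition free_sizes :: "nat \<Rightarrow> 'b ugraph \<Rightarrow> nat set" where
  "free_sizes n H = {card (edges G) | G :: nat ugraph.
     simple_graph G \<and> card (verts G) = n \<and> \<not> contains_copy G H}"

lemma ex_num_eq: "ex_num n H = Max (free_sizes n H)"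
  by (simp add: ex_num_def free_sizes_def)

lemma finite_free_sizes: "finite (free_sizes n H)"
proof -
  have "free_sizes n H \<subseteq> {..2 ^ n}"
  proof
    fix m assume "m \<in> free_sizes n H"
    then obtain G :: "nat ugraph" where G: "m = card (edges G)" "simple_graph G" "card (verts G) = n"
      by (auto simp: free_sizes_def)
    then have "edges G \<subseteq> Pow (verts G)" "finite (verts G)" by (auto simp: simple_graph_def)
    then have "card (edges G) \<le> 2 ^ n" using G(3) by (metis card_Pow card_mono finite_Pow_iff)
    then show "m \<in> {..2 ^ n}" using G by simp
  qed
  then show ?thesis by (rule finite_subset) simp
qed

lemma free_sizes_nonempty:
  assumes "e \<in> edges H" "\<And>e. e \<in> edges H \<Longrightarrow> \<exists>u\<in>verts H. \<exists>v\<in>verts H. e = {u, v}"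
  shows "free_sizes n H \<noteq> {}"
proof -
  define G :: "nat ugraph" where "G = \<lparr>verts = {..<n}, edges = {}\<rparr>"
  have "\<not> contains_copy G H"
  proof
    assume "contains_copy G H"
    then obtain f where "\<And>e. e \<in> edges H \<Longrightarrow> f ` e \<in> edges G" using contains_copyE[OF _ assms(2)] by metis
    then show False using assms(1) by (auto simp: G_def)
  qed
  moreover have "simple_graph G" "card (verts G) = n" by (simp_all add: G_def simple_graph_def)
  ultimately have "card (edges G) \<in> free_sizes n H" unfolding free_sizes_def by blast
  then show ?thesis by blast
qed

lemma rung_in_bowtie:
  assumes "i < 2 * l"
  shows "Inl ` {(i, 0), (i, 1)} \<in> edges (bowtie_graph l)"
proof -
  have "{(i, 0), (i, 1)} \<in> edges (prism_graph l)" using assms by (rule rung_in_prism)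
  then have "identify_on glued_edge ` Inl ` {(i, 0), (i, 1)} \<in> edges (bowtie_graph l)"
    unfolding edges_bowtie by blast
  then show ?thesis by (simp add: identify_on_def)
qed

text \<open>A copy of the bowtie graph yields a copy of its subgraph, so the family for the subgraph
  is the smaller one; it must be nonempty for its \<open>Max\<close> to be meaningful.\<close>

lemma ex_num_bowtie_minus_le:
  assumes l: "2 \<le> l" and e2: "card (e2 \<inter> merged_edge) = 1"
  shows "ex_num n (bowtie_minus_graph l e2) \<le> ex_num n (bowtie_graph l)"
proof -
  let ?H = "bowtie_minus_graph l e2"
  have H: "verts ?H = verts (bowtie_graph l)" "edges ?H \<subseteq> edges (bowtie_graph l)"
    by (auto simp: bowtie_minus_graph_def)
  then have ends: "\<exists>u\<in>verts ?H. \<exists>v\<in>verts ?H. e = {u, v}" if "e \<in> edges ?H" for e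
    using bowtie_edge_ends that by blast
  \<comment> \<open>This rung avoids the merged edge, which \<open>e2\<close> meets, so it survives
    the deletion and provides the edge for \<open>free_sizes_nonempty\<close>.\<close>
  let ?e = "Inl ` {(1, 0), (1, 1)} :: ((nat \<times> nat) + (nat \<times> nat)) set"
  have "?e \<inter> merged_edge = {}" by (auto simp: merged_edge_def glued_edge_def)
  then have "?e \<noteq> merged_edge" "?e \<noteq> e2" using e2 by auto
  then have "?e \<in> edges ?H"
    using rung_in_bowtie[of 1 l] l by (simp add: bowtie_minus_graph_def)
  then have ne: "free_sizes n ?H \<noteq> {}" using ends by (rule free_sizes_nonempty)
  have "contains_copy G ?H" if G: "simple_graph G" and c: "contains_copy G (bowtie_graph l)" for G :: "nat ugraph"
  proof -
    obtain f where f: "inj_on f (verts (bowtie_graph l))" "f ` verts (bowtie_graph l) \<subseteq> verts G"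
      "\<And>e. e \<in> edges (bowtie_graph l) \<Longrightarrow> f ` e \<in> edges G"
      using contains_copyE[OF c bowtie_edge_ends] by blast
    show ?thesis
      using f H ends by (intro contains_copyI[OF G, of f]) (simp_all, blast+)
  qed
  then have "free_sizes n ?H \<subseteq> free_sizes n (bowtie_graph l)"
    unfolding free_sizes_def by blast
  then show ?thesis
    unfolding ex_num_eq using ne finite_free_sizes by (intro Max_mono)
qed

lemma ex_num_bowtie_le:
  assumes l: "7 \<le> l"
  shows "\<exists>K. \<forall>n. real (ex_num n (bowtie_graph l)) \<le> K * real n powr (3/2)"
proof -
  obtain K where K: "\<And>adj (V :: nat set). finite V \<Longrightarrow> (\<And>x y. adj x y \<Longrightarrow> adj y x) \<Longrightarrow>
    \<not> ladder_pair adj (2 * l) \<Longrightarrow> edge_count adj V V \<le> K * real (card V) powr (3/2)"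
    using edge_count_bound_if_no_ladder_pair[OF l, where 'v = nat] by blast
  have "real (ex_num n (bowtie_graph l)) \<le> K * real n powr (3/2)" for n
  proof -
    have "free_sizes n (bowtie_graph l) \<noteq> {}"
      using rung_in_bowtie[of 0 l] l bowtie_edge_ends by (intro free_sizes_nonempty) auto
    then have "ex_num n (bowtie_graph l) \<in> free_sizes n (bowtie_graph l)"
      unfolding ex_num_eq by (intro Max_in finite_free_sizes)
    then obtain G :: "nat ugraph" where G: "ex_num n (bowtie_graph l) = card (edges G)" "simple_graph G"
      "card (verts G) = n" "\<not> contains_copy G (bowtie_graph l)"
      unfolding free_sizes_def by blast
    have "\<not> ladder_pair (\<lambda>u v. {u, v} \<in> edges G) (2 * l)"
      using G(2,4) contains_bowtie_if_ladder_pair by blast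
    moreover have "finite (verts G)" using G(2) by (simp add: simple_graph_def)
    ultimately have "edge_count (\<lambda>u v. {u, v} \<in> edges G) (verts G) (verts G) \<le> K * real n powr (3/2)"
      using K[of "verts G" "\<lambda>u v. {u, v} \<in> edges G"] G(3) by (simp add: insert_commute)
    moreover have "real (card (edges G)) \<le> edge_count (\<lambda>u v. {u, v} \<in> edges G) (verts G) (verts G)"
      using card_edges_le_edge_count[OF G(2)] by simp
    ultimately show ?thesis using G(1) by simp
  qed
  then show ?thesis by blast
qed

theorem theorem3p1:
  fixes l :: nat
  assumes "l \<ge> 7"
  shows "(\<forall>n. \<forall>e2 \<in> edges (bowtie_graph l). card (e2 \<inter> merged_edge) = 1 \<longrightarrow>
            ex_num n (bowtie_minus_graph l e2) \<le> ex_num n (bowtie_graph l)) \<and>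
         (\<lambda>n. real (ex_num n (bowtie_graph l))) \<in> O(\<lambda>n. real n powr (3 / 2))"
proof
  show "\<forall>n. \<forall>e2 \<in> edges (bowtie_graph l). card (e2 \<inter> merged_edge) = 1 \<longrightarrow>
      ex_num n (bowtie_minus_graph l e2) \<le> ex_num n (bowtie_graph l)"
    using assms by (simp add: ex_num_bowtie_minus_le)
  obtain K where "\<And>n. real (ex_num n (bowtie_graph l)) \<le> K * real n powr (3/2)"
    using ex_num_bowtie_le[OF assms] by blast
  then show "(\<lambda>n. real (ex_num n (bowtie_graph l))) \<in> O(\<lambda>n. real n powr (3 / 2))"
    by (intro bigoI[where c = K]) simp
qed

end
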